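(* Let $A$ be a formula. Any test $T$ of $A$ is correctly typeable by $A^\bot$, that is, $T\vdash_{\mathsf{MLL}^\maltese}A^\bot$.
   Context: **Nets.** Fix a countable set of positions. A hypergraph has a finite set $V$ of positions and a finite set $E$ of labelled links; each link has a source and a target, which are finite sequences of pairwise distinct positions, the source and the target being disjoint. The only links used are: tensor links $\langle p_1,p_2\rhd_\otimes p\rangle$ and par links $\langle p_1,p_2\rhd_\wp p\rangle$ (two inputs, one output), cut links $\langle p_1,p_2\rhd_{\mathsf{cut}}\rangle$ (two inputs, no output), and daimon links $\langle\rhd_\maltese p_1,\dots,p_n\rangle$, $n\ge 0$ (no input). ($\wp$ denotes the par connective.) The sum takes the union of positions and the disjoint union of links. A conclusion is a position that is in the source of no link. A (multiplicative) net $S$ is a finite sum of such links in which every position is in the target of exactly one link and in the source of at most one link, together with a total order on its conclusions; $S(i)$ is the $i$-th conclusion. A net is cut-free if it has no cut link. Nets are considered up to isomorphism. Initial positions are the outputs of daimon links. **Logic.** Propositional variables form a countable set with an involution $X\mapsto X^\bot$. Formulas: $A,B::=X\mid A\wp B\mid A\otimes B$, with $(A\wp B)^\bot=A^\bot\otimes B^\bot$, $(A\otimes B)^\bot=A^\bot\wp B^\bot$. Sequents are finite sequences of formulas. $\mathsf{MLL}^\maltese$ proofs are trees built with the rules: ($\maltese$) infer any $\Gamma$ with no premise; ($\wp$) from $\Gamma,A,B$ infer $\Gamma,A\wp B$; ($\otimes$) from $\Gamma,A$ and $\Delta,B$ infer $\Gamma,\Delta,A\otimes B$; (cut) from $\Gamma,A$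 and $\Delta,A^\bot$ infer $\Gamma,\Delta$; (ex) exchange of two consecutive formulas. A net $S$ represents a proof $\pi$ of $A_1,\dots,A_n$ (the $i$-th conclusion of $S$ corresponding to $A_i$), inductively: a $\maltese$-rule is represented by a single daimon link $\langle\rhd_\maltese p_1,\dots,p_n\rangle$ with conclusions ordered $p_1,\dots,p_n$; a $\wp$-rule by adding a par link with fresh output to the conclusions for $A,B$ of a net representing the premise; a $\otimes$-rule (resp. cut-rule) by the disjoint sum of nets representing the premises plus a tensor link with fresh output (resp. a cut link) on the conclusions for the two active formulas; exchange by exchanging the two conclusions in the order. $S\vdash_{\mathsf{MLL}^\maltese}\Gamma$ means that $S$ represents some $\mathsf{MLL}^\maltese$ proof of $\Gamma$. **Atomic testability.** A formula labelling of a cut-free net $S$ is a function $\tau$ from its positions to formulas such that $\tau(p)=\tau(p_1)\wp\tau(p_2)$ for each par link $\langle p_1,p_2\rhd_\wp p\rangle$ and $\tau(p)=\tau(p_1)\otimes\tau(p_2)$ for each tensor link $\langle p_1,p_2\rhd_\otimes p\rangle$ of $S$. It is atomic if every output of every daimon link is labelled by a propositional variable. A cut-free net $S$ with $n$ conclusions is atomically testable by $A_1,\dots,A_n$ if it has an atomic formula labelling $\tau$ with $\tau(S(i))=A_i$ for all $i$. **Natural partitions.** In such a net $S$ there is a binary tree of connective links above each conclusion; each initial position $p$ is determined by the index $i$ of the conclusion $S(i)$ below it and its address, the left/right word leading from $S(i)$ up to $p$. Order the $n$ initial positions lexicographically by (index, address), left before right. For a partition $P$ of the initial positions of $S$, $\mathbf{Nat}_S(P)$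 is the corresponding partition of $\{1,\dots,n\}$. $\mathsf P_\maltese(S)$ is the partition $\{\mathrm t(d)\mid d\text{ a daimon link of }S\}$, $\mathrm t(d)$ being the set of outputs of $d$. **Switchings.** For a par link $\langle p_1,p_2\rhd_\wp p\rangle$ of a net, a left (resp. right) switching step deletes this link and replaces $p_1$ (resp. $p_2$) by $p$ in the target of the link having it as an output; $p_2$ (resp. $p_1$) becomes a new (last) conclusion. A switching $\sigma S$ of $S$ is a normal form of $S$ for these steps (so it has no par link). Its initial positions are identified with those of $S$ via the replacements. For cut-free $S$, $\uparrow^i\sigma S$ is the partition of the initial positions having one class for each conclusion $q$ of $\sigma S$, namely the set of initial positions above $q$ in $\sigma S$ (those from which $q$ is reached by going repeatedly from an input to an output of a link). **Tests.** A cut-free net $T$ is a test of a formula $A$ if $T$ is atomically testable by $A^\bot$ and there exist a (cut-free) net $S$ atomically testable by $A$ and a switching $\sigma S$ of $S$ such that $\mathbf{Nat}_T(\mathsf P_\maltese(T))=\mathbf{Nat}_S(\uparrow^i\sigma S)$. *)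

theory Defs
  imports "HOL-Library.Multiset" "HOL-Library.Countable"
begin

section \<open>Nets\<close>

datatype 'p link =
    TensorLink 'p 'p 'p
  | ParLink 'p 'p 'p
  | CutLink 'p 'p
  | DaimonLink "'p list"

fun source :: "'p link \<Rightarrow> 'p list" where
  "source (TensorLink p\<^sub>1 p\<^sub>2 p) = [p\<^sub>1, p\<^sub>2]"
| "source (ParLink p\<^sub>1 p\<^sub>2 p) = [p\<^sub>1, p\<^sub>2]"
| "source (CutLink p\<^sub>1 p\<^sub>2) = [p\<^sub>1, p\<^sub>2]"
| "source (DaimonLink ps) = []"

fun target :: "'p link \<Rightarrow> 'p list" where
  "target (TensorLink p\<^sub>1 p\<^sub>2 p) = [p]"
| "target (ParLink p\<^sub>1 p\<^sub>2 p) = [p]"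
| "target (CutLink p\<^sub>1 p\<^sub>2) = []"
| "target (DaimonLink ps) = ps"

text \<open>
  Links are kept in a multiset, because distinct links may have the same label and the same
  source and target (this happens for daimon links without outputs). The list holds the
  conclusions in their order; the positions are those of the links, see \<open>positions\<close>.
\<close>

datatype 'p net = Net (links: "'p link multiset") (concl: "'p list")

definition positions :: "'p net \<Rightarrow> 'p set" where
  "positions S = (\<Union>l \<in> set_mset (links S). set (source l) \<union> set (target l))"

definition is_net :: "'p net \<Rightarrow> bool" where
  "is_net S \<longleftrightarrow>
     (\<forall>l \<in># links S. distinct (source l @ target l)) \<and>
     (\<forall>p \<in> positions S. size {#l \<in># links S. p \<in> set (target l)#} = 1) \<and>
     (\<forall>p \<in> positions S. size {#l \<in># links S. p \<in> set (source l)#} \<le> 1) \<and>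
     distinct (concl S) \<and>
     set (concl S) = {p \<in> positions S. \<forall>l \<in># links S. p \<notin> set (source l)}"

definition cut_free :: "'p net \<Rightarrow> bool" where
  "cut_free S \<longleftrightarrow> (\<forall>p\<^sub>1 p\<^sub>2. CutLink p\<^sub>1 p\<^sub>2 \<notin># links S)"

definition initials :: "'p net \<Rightarrow> 'p set" where
  "initials S = {p. \<exists>ps. DaimonLink ps \<in># links S \<and> p \<in> set ps}"

section \<open>Formulas, proofs, and their representation by nets\<close>

datatype 'v formula = Var 'v | Par "'v formula" "'v formula" | Tensor "'v formula" "'v formula"

text \<open>The parameter \<open>dual\<close> is the involution on propositional variables.\<close>

fun neg :: "('v \<Rightarrow> 'v) \<Rightarrow> 'v formula \<Rightarrow> 'v formula" where
  "neg dual (Var X) = Var (dual X)"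
| "neg dual (Par A B) = Tensor (neg dual A) (neg dual B)"
| "neg dual (Tensor A B) = Par (neg dual A) (neg dual B)"

datatype 'v mll_proof =
    DaimonRule "'v formula list"
  | ParRule "'v mll_proof"
  | TensorRule "'v mll_proof" "'v mll_proof"
  | CutRule "'v mll_proof" "'v mll_proof"
  | ExRule nat "'v mll_proof"

text \<open>\<open>ExRule k\<close> exchanges the formulas at indices \<open>k\<close> and \<open>k + 1\<close>, counted from 0.\<close>

inductive derives :: "('v \<Rightarrow> 'v) \<Rightarrow> 'v mll_proof \<Rightarrow> 'v formula list \<Rightarrow> bool" for dual where
  derives_daimon: "derives dual (DaimonRule \<Gamma>) \<Gamma>"
| derives_par:
    "derives dual \<pi> (\<Gamma> @ [A, B]) \<Longrightarrow> derives dual (ParRule \<pi>) (\<Gamma> @ [Par A B])"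
| derives_tensor:
    "derives dual \<pi>\<^sub>1 (\<Gamma> @ [A]) \<Longrightarrow> derives dual \<pi>\<^sub>2 (\<Delta> @ [B]) \<Longrightarrow>
     derives dual (TensorRule \<pi>\<^sub>1 \<pi>\<^sub>2) (\<Gamma> @ \<Delta> @ [Tensor A B])"
| derives_cut:
    "derives dual \<pi>\<^sub>1 (\<Gamma> @ [A]) \<Longrightarrow> derives dual \<pi>\<^sub>2 (\<Delta> @ [neg dual A]) \<Longrightarrow>
     derives dual (CutRule \<pi>\<^sub>1 \<pi>\<^sub>2) (\<Gamma> @ \<Delta>)"
| derives_ex:
    "derives dual \<pi> (\<Gamma> @ [A, B] @ \<Delta>) \<Longrightarrow>
     derives dual (ExRule (length \<Gamma>) \<pi>) (\<Gamma> @ [B, A] @ \<Delta>)"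

text \<open>
  Positions are arbitrary up to the distinctness and freshness conditions, so this relation is
  invariant under injective renaming of positions, as required for nets up to isomorphism.
\<close>

inductive represents :: "'p net \<Rightarrow> 'v mll_proof \<Rightarrow> bool" where
  represents_daimon:
    "distinct ps \<Longrightarrow> length ps = length \<Gamma> \<Longrightarrow>
     represents (Net {#DaimonLink ps#} ps) (DaimonRule \<Gamma>)"
| represents_par:
    "represents (Net N (cs @ [p\<^sub>1, p\<^sub>2])) \<pi> \<Longrightarrow> p \<notin> positions (Net N (cs @ [p\<^sub>1, p\<^sub>2])) \<Longrightarrow>
     represents (Net (N + {#ParLink p\<^sub>1 p\<^sub>2 p#}) (cs @ [p])) (ParRule \<pi>)"
| represents_tensor:
    "represents (Net N (cs @ [p\<^sub>1])) \<pi>\<^sub>1 \<Longrightarrow> represents (Net M (ds @ [p\<^sub>2])) \<pi>\<^sub>2 \<Longrightarrow>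
     positions (Net N (cs @ [p\<^sub>1])) \<inter> positions (Net M (ds @ [p\<^sub>2])) = {} \<Longrightarrow>
     p \<notin> positions (Net N (cs @ [p\<^sub>1])) \<union> positions (Net M (ds @ [p\<^sub>2])) \<Longrightarrow>
     represents (Net (N + M + {#TensorLink p\<^sub>1 p\<^sub>2 p#}) (cs @ ds @ [p])) (TensorRule \<pi>\<^sub>1 \<pi>\<^sub>2)"
| represents_cut:
    "represents (Net N (cs @ [p\<^sub>1])) \<pi>\<^sub>1 \<Longrightarrow> represents (Net M (ds @ [p\<^sub>2])) \<pi>\<^sub>2 \<Longrightarrow>
     positions (Net N (cs @ [p\<^sub>1])) \<inter> positions (Net M (ds @ [p\<^sub>2])) = {} \<Longrightarrow>
     represents (Net (N + M + {#CutLink p\<^sub>1 p\<^sub>2#}) (cs @ ds)) (CutRule \<pi>\<^sub>1 \<pi>\<^sub>2)"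
| represents_ex:
    "represents (Net N (cs @ [p, q] @ ds)) \<pi> \<Longrightarrow>
     represents (Net N (cs @ [q, p] @ ds)) (ExRule (length cs) \<pi>)"

definition typeable :: "('v \<Rightarrow> 'v) \<Rightarrow> 'p net \<Rightarrow> 'v formula list \<Rightarrow> bool" where
  "typeable dual S \<Gamma> \<longleftrightarrow> (\<exists>\<pi>. derives dual \<pi> \<Gamma> \<and> represents S \<pi>)"

section \<open>Atomic testability\<close>

definition formula_labelling :: "'p net \<Rightarrow> ('p \<Rightarrow> 'v formula) \<Rightarrow> bool" where
  "formula_labelling S \<tau> \<longleftrightarrow>
     (\<forall>p\<^sub>1 p\<^sub>2 p. ParLink p\<^sub>1 p\<^sub>2 p \<in># links S \<longrightarrow> \<tau> p = Par (\<tau> p\<^sub>1) (\<tau> p\<^sub>2)) \<and>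
     (\<forall>p\<^sub>1 p\<^sub>2 p. TensorLink p\<^sub>1 p\<^sub>2 p \<in># links S \<longrightarrow> \<tau> p = Tensor (\<tau> p\<^sub>1) (\<tau> p\<^sub>2))"

definition atomic_labelling :: "'p net \<Rightarrow> ('p \<Rightarrow> 'v formula) \<Rightarrow> bool" where
  "atomic_labelling S \<tau> \<longleftrightarrow>
     formula_labelling S \<tau> \<and> (\<forall>p \<in> initials S. \<exists>X. \<tau> p = Var X)"

definition atomically_testable :: "'p net \<Rightarrow> 'v formula list \<Rightarrow> bool" where
  "atomically_testable S As \<longleftrightarrow>
     is_net S \<and> cut_free S \<and> (\<exists>\<tau>. atomic_labelling S \<tau> \<and> map \<tau> (concl S) = As)"

section \<open>Natural partitions\<close>

text \<open>
  \<open>address S q w p\<close>: the word \<open>w\<close> (\<open>False\<close> for left, \<open>True\<close> for right) leads from \<open>q\<close> up to \<open>p\<close>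
  through connective links of \<open>S\<close>.
\<close>

inductive address :: "'p net \<Rightarrow> 'p \<Rightarrow> bool list \<Rightarrow> 'p \<Rightarrow> bool" for S where
  address_here: "address S q [] q"
| address_left:
    "ParLink p\<^sub>1 p\<^sub>2 q \<in># links S \<or> TensorLink p\<^sub>1 p\<^sub>2 q \<in># links S \<Longrightarrow>
     address S p\<^sub>1 w p \<Longrightarrow> address S q (False # w) p"
| address_right:
    "ParLink p\<^sub>1 p\<^sub>2 q \<in># links S \<or> TensorLink p\<^sub>1 p\<^sub>2 q \<in># links S \<Longrightarrow>
     address S p\<^sub>2 w p \<Longrightarrow> address S q (True # w) p"

definition located :: "'p net \<Rightarrow> 'p \<Rightarrow> nat \<Rightarrow> bool list \<Rightarrow> bool" where
  "located S p i w \<longleftrightarrow> i < length (concl S) \<and> address S (concl S ! i) w p"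

definition precedes :: "'p net \<Rightarrow> 'p \<Rightarrow> 'p \<Rightarrow> bool" where
  "precedes S p q \<longleftrightarrow>
     (\<exists>i u j v. located S p i u \<and> located S q j v \<and>
        ((i, u), (j, v)) \<in> less_than <*lex*> lexord {(False, True)})"

definition rank :: "'p net \<Rightarrow> 'p \<Rightarrow> nat" where
  "rank S p = Suc (card {q \<in> initials S. precedes S q p})"

definition Nat_part :: "'p net \<Rightarrow> 'p set set \<Rightarrow> nat set set" where
  "Nat_part S P = (\<lambda>c. rank S ` c) ` P"

text \<open>A daimon link without outputs contributes the empty class.\<close>

definition daimon_part :: "'p net \<Rightarrow> 'p set set" where
  "daimon_part S = {set ps | ps. DaimonLink ps \<in># links S}"

section \<open>Switchings\<close>

fun retarget :: "('p \<Rightarrow> 'p) \<Rightarrow> 'p link \<Rightarrow> 'p link" where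
  "retarget f (TensorLink p\<^sub>1 p\<^sub>2 p) = TensorLink p\<^sub>1 p\<^sub>2 (f p)"
| "retarget f (ParLink p\<^sub>1 p\<^sub>2 p) = ParLink p\<^sub>1 p\<^sub>2 (f p)"
| "retarget f (CutLink p\<^sub>1 p\<^sub>2) = CutLink p\<^sub>1 p\<^sub>2"
| "retarget f (DaimonLink ps) = DaimonLink (map f ps)"

text \<open>
  \<open>switch_step S f S'\<close>: a step from \<open>S\<close> to \<open>S'\<close> that replaces positions in targets according to
  \<open>f\<close>. In a net, the replaced position is in the target of only one link, so it is enough to
  replace it in all targets.
\<close>

inductive switch_step :: "'p net \<Rightarrow> ('p \<Rightarrow> 'p) \<Rightarrow> 'p net \<Rightarrow> bool" where
  switch_left:
    "switch_step (Net (N + {#ParLink p\<^sub>1 p\<^sub>2 p#}) cs) (id(p\<^sub>1 := p))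
       (Net (image_mset (retarget (id(p\<^sub>1 := p))) N) (cs @ [p\<^sub>2]))"
| switch_right:
    "switch_step (Net (N + {#ParLink p\<^sub>1 p\<^sub>2 p#}) cs) (id(p\<^sub>2 := p))
       (Net (image_mset (retarget (id(p\<^sub>2 := p))) N) (cs @ [p\<^sub>1]))"

inductive switch_steps :: "'p net \<Rightarrow> ('p \<Rightarrow> 'p) \<Rightarrow> 'p net \<Rightarrow> bool" where
  switch_refl: "switch_steps S id S"
| switch_trans: "switch_steps S f S' \<Longrightarrow> switch_step S' g S'' \<Longrightarrow> switch_steps S (g \<circ> f) S''"

text \<open>
  \<open>switching S f R\<close>: \<open>R\<close> is a switching of \<open>S\<close>, and \<open>f\<close> identifies the initial positions of \<open>S\<close>
  with those of \<open>R\<close>.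
\<close>

definition switching :: "'p net \<Rightarrow> ('p \<Rightarrow> 'p) \<Rightarrow> 'p net \<Rightarrow> bool" where
  "switching S f R \<longleftrightarrow> switch_steps S f R \<and> (\<nexists>g R'. switch_step R g R')"

definition flow :: "'p net \<Rightarrow> ('p \<times> 'p) set" where
  "flow S = {(p, q). \<exists>l \<in># links S. p \<in> set (source l) \<and> q \<in> set (target l)}"

definition up_part :: "'p net \<Rightarrow> ('p \<Rightarrow> 'p) \<Rightarrow> 'p net \<Rightarrow> 'p set set" where
  "up_part S f R = (\<lambda>q. {p \<in> initials S. (f p, q) \<in> (flow R)\<^sup>*}) ` set (concl R)"

section \<open>Tests\<close>

definition test :: "('v \<Rightarrow> 'v) \<Rightarrow> 'v formula \<Rightarrow> 'p net \<Rightarrow> bool" where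
  "test dual A T \<longleftrightarrow>
     atomically_testable T [neg dual A] \<and>
     (\<exists>(S :: 'p net) f R. atomically_testable S [A] \<and> switching S f R \<and>
        Nat_part T (daimon_part T) = Nat_part S (up_part S f R))"

end

(* Dualizing A exchanges tensor and par. In a switching of a tree for A, every tensor merges the
   components of its two premises, and every par keeps one of them and cuts off the other. In the
   dual tree T, whose daimons are these components, a par is thus applied to two premises of the
   same component, while a tensor joins a component to one that is new: this is exactly what a
   derivation has to do, so the switching can be read as a sequentialization of T. *)

theory Submission
  imports Defs
begin

section \<open>Trees of connective links\<close>

text \<open>The partitions of \<open>T\<close> and of the switching live on different positions and
  meet only as sets of ranks. \<open>T\<close> and the net \<open>S\<close> behind the switching
  have trees of the same shape up to exchanging connectives, ranks number the leaves from left to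
  right, and \<open>rank T\<close> is injective on leaves; hence the switching determines the
  classes of \<open>T\<close>. \<open>daimon_part\<close> is a set while links form a multiset, so
  repeated daimons without outputs would be invisible in it; they are excluded because no component
  of a switched tree is empty. \<open>is_net\<close> alone allows cycles; a labelling excludes them,
  as formula sizes grow strictly from input to output. Switching steps come in any order and rename
  targets; reachability in the result is therefore read back as reachability in \<open>S\<close>
  along tensor edges and kept par edges. Finally, a component is in general shared by the two
  branches of a tensor, so subtrees of \<open>T\<close> cannot be sequentialized in isolation: the
  induction glues a subtree onto an arbitrary typeable net that has the root class among its
  conclusions.\<close>

datatype 'p ctree = Leaf (root: 'p) | Node bool (root: 'p) "'p ctree" "'p ctree"

text \<open>A Boolean for the connective turns dualization into the negation in \<open>flip\<close>
  and lets par and tensor links be treated uniformly.\<close>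

fun conn :: "bool \<Rightarrow> 'p \<Rightarrow> 'p \<Rightarrow> 'p \<Rightarrow> 'p link" where
  "conn True = ParLink"
| "conn False = TensorLink"

fun nodes :: "'p ctree \<Rightarrow> 'p list" where
  "nodes (Leaf p) = [p]"
| "nodes (Node k p a b) = p # nodes a @ nodes b"

fun leaves :: "'p ctree \<Rightarrow> 'p list" where
  "leaves (Leaf p) = [p]"
| "leaves (Node k p a b) = leaves a @ leaves b"

fun clinks :: "'p ctree \<Rightarrow> 'p link multiset" where
  "clinks (Leaf p) = {#}"
| "clinks (Node k p a b) = add_mset (conn k (root a) (root b) p) (clinks a + clinks b)"

fun flip :: "'p ctree \<Rightarrow> 'p ctree" where
  "flip (Leaf p) = Leaf p"
| "flip (Node k p a b) = Node (\<not> k) p (flip a) (flip b)"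

text \<open>Only the connectives are compared; the variable at a leaf is ignored, so that a formula
  and its dual differ only by \<open>flip\<close>.\<close>

fun fits :: "'p ctree \<Rightarrow> 'v formula \<Rightarrow> bool" where
  "fits (Leaf p) (Var X) = True"
| "fits (Node k p a b) (Par A B) = (k \<and> fits a A \<and> fits b B)"
| "fits (Node k p a b) (Tensor A B) = (\<not> k \<and> fits a A \<and> fits b B)"
| "fits _ _ = False"

lemma source_conn [simp]: "source (conn k a b p) = [a, b]"
  and target_conn [simp]: "target (conn k a b p) = [p]"
  by (cases k; simp)+

lemma conn_inject [simp]: "conn k a b p = conn k' a' b' p' \<longleftrightarrow> k = k' \<and> a = a' \<and> b = b' \<and> p = p'"
  by (cases k; cases k'; simp)

lemma conn_neq_DaimonLink [simp]: "conn k a b p \<noteq> DaimonLink ps" "DaimonLink ps \<noteq> conn k a b p"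
  by (cases k; simp)+

lemma conn_neq_CutLink [simp]: "conn k a b p \<noteq> CutLink c d" "CutLink c d \<noteq> conn k a b p"
  by (cases k; simp)+

lemma conn_eq_ParLink [simp]: "conn k a b p = ParLink a' b' p' \<longleftrightarrow> k \<and> a = a' \<and> b = b' \<and> p = p'"
  and conn_eq_TensorLink [simp]: "conn k a b p = TensorLink a' b' p' \<longleftrightarrow> \<not> k \<and> a = a' \<and> b = b' \<and> p = p'"
  by (cases k; simp)+

lemma link_cases:
  obtains (conn) k a b p where "l = conn k a b p" | (cut) a b where "l = CutLink a b"
    | (daimon) ps where "l = DaimonLink ps"
proof (cases l)
  case (TensorLink a b p)
  then show ?thesis using conn[of False] by simp
next
  case (ParLink a b p)
  then show ?thesis using conn[of True] by simp
qed (use cut daimon in auto)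

lemma root_in_nodes [simp]: "root t \<in> set (nodes t)"
  by (cases t) auto

lemma leaves_subset_nodes: "set (leaves t) \<subseteq> set (nodes t)"
  by (induction t) auto

lemma distinct_leaves: "distinct (nodes t) \<Longrightarrow> distinct (leaves t)"
  using leaves_subset_nodes by (induction t) fastforce+

lemma root_flip [simp]: "root (flip t) = root t"
  by (cases t) auto

lemma nodes_flip [simp]: "nodes (flip t) = nodes t"
  by (induction t) auto

lemma leaves_flip [simp]: "leaves (flip t) = leaves t"
  by (induction t) auto

lemma flip_flip [simp]: "flip (flip t) = t"
  by (induction t) auto

lemma root_map_ctree [simp]: "root (map_ctree \<phi> t) = \<phi> (root t)"
  by (cases t) auto

lemma leaves_map_ctree [simp]: "leaves (map_ctree \<phi> t) = map \<phi> (leaves t)"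
  by (induction t) auto

lemma set_ctree_nodes: "set_ctree t = set (nodes t)"
  by (induction t) auto

lemma fits_flip: "fits t (neg dual A) \<longleftrightarrow> fits (flip t) A"
  by (induction t A rule: fits.induct) auto

text \<open>Trees that fit the same formula have the same shape. Distinct nodes in \<open>s\<close>
  let the renamings of the two subtrees and of the root be pasted into one function.\<close>

lemma ex_map_ctree:
  assumes "fits s A" "fits t A" "distinct (nodes s)"
  shows "\<exists>\<phi>. map_ctree \<phi> s = t"
proof -
  have step: "\<exists>\<phi>. map_ctree \<phi> (Node k p a b) = Node k q a' b'"
    if IH: "map_ctree \<phi>\<^sub>1 a = a'" "map_ctree \<phi>\<^sub>2 b = b'" and d: "distinct (nodes (Node k p a b))"
    for k and p :: 'a and q :: 'c and a b a' b' \<phi>\<^sub>1 \<phi>\<^sub>2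
  proof -
    let ?\<phi> = "\<lambda>x. if x = p then q else if x \<in> set (nodes a) then \<phi>\<^sub>1 x else \<phi>\<^sub>2 x"
    have "map_ctree ?\<phi> a = map_ctree \<phi>\<^sub>1 a" "map_ctree ?\<phi> b = map_ctree \<phi>\<^sub>2 b"
      using d by (auto intro!: ctree.map_cong0 simp: set_ctree_nodes)
    then show ?thesis using IH by (intro exI[of _ ?\<phi>]) simp
  qed
  show ?thesis
    using assms
  proof (induction s A arbitrary: t rule: fits.induct)
    case (1 p X)
    then show ?case by (cases t) auto
  next
    case (2 k p a b A B)
    then obtain q a' b' where t: "t = Node k q a' b'" "fits a' A" "fits b' B"
      by (cases t) auto
    then obtain \<phi>\<^sub>1 \<phi>\<^sub>2 where "map_ctree \<phi>\<^sub>1 a = a'" "map_ctree \<phi>\<^sub>2 b = b'"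
      using "2.IH"(1)[OF _ t(2)] "2.IH"(2)[OF _ t(3)] "2.prems" by (auto simp: t(1))
    from step[OF this "2.prems"(3)] show ?case unfolding t(1) .
  next
    case (3 k p a b A B)
    then obtain q a' b' where t: "t = Node k q a' b'" "fits a' A" "fits b' B"
      by (cases t) auto
    then obtain \<phi>\<^sub>1 \<phi>\<^sub>2 where "map_ctree \<phi>\<^sub>1 a = a'" "map_ctree \<phi>\<^sub>2 b = b'"
      using "3.IH"(1)[OF _ t(2)] "3.IH"(2)[OF _ t(3)] "3.prems" by (auto simp: t(1))
    from step[OF this "3.prems"(3)] show ?case unfolding t(1) .
  qed auto
qed

section \<open>Links of nets\<close>

lemma filter_mset_singletonD:
  assumes "size {#x \<in># M. P x#} \<le> 1" "x \<in># M" "y \<in># M" "P x" "P y"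
  shows "x = y"
proof (rule ccontr)
  assume "x \<noteq> y"
  have "{#x, y#} \<subseteq># {#x \<in># M. P x#}"
  proof (rule mset_subset_eqI)
    fix z
    show "count {#x, y#} z \<le> count {#x \<in># M. P x#} z"
      using assms(2-5) \<open>x \<noteq> y\<close> by auto
  qed
  then have "size {#x, y#} \<le> 1" using size_mset_mono assms(1) order_trans by blast
  then show False by simp
qed

lemma in_positionsI:
  "l \<in># links S \<Longrightarrow> p \<in> set (source l) \<Longrightarrow> p \<in> positions S"
  "l \<in># links S \<Longrightarrow> p \<in> set (target l) \<Longrightarrow> p \<in> positions S"
  by (auto simp: positions_def)

lemma is_net_size_target:
  "is_net S \<Longrightarrow> p \<in> positions S \<Longrightarrow> size {#l \<in># links S. p \<in> set (target l)#} = 1"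
  unfolding is_net_def by simp

lemma is_net_target_unique:
  assumes "is_net S" "l \<in># links S" "l' \<in># links S" "p \<in> set (target l)" "p \<in> set (target l')"
  shows "l = l'"
proof (rule filter_mset_singletonD)
  show "size {#l \<in># links S. p \<in> set (target l)#} \<le> 1"
    using is_net_size_target[OF assms(1) in_positionsI(2)[OF assms(2,4)]] by simp
qed (use assms in auto)

lemma is_net_source_unique:
  assumes "is_net S" "l \<in># links S" "l' \<in># links S" "p \<in> set (source l)" "p \<in> set (source l')"
  shows "l = l'"
proof (rule filter_mset_singletonD)
  show "size {#l \<in># links S. p \<in> set (source l)#} \<le> 1"
    using assms(1) in_positionsI(1)[OF assms(2,4)] unfolding is_net_def by simp
qed (use assms in auto)

lemma is_net_target_ex:
  assumes "is_net S" "p \<in> positions S"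
  obtains l where "l \<in># links S" "p \<in> set (target l)"
proof -
  have "{#l \<in># links S. p \<in> set (target l)#} \<noteq> {#}"
    using is_net_size_target[OF assms] by (metis size_empty zero_neq_one)
  then obtain l where "l \<in># {#l \<in># links S. p \<in> set (target l)#}"
    by (meson multiset_nonemptyE)
  then show ?thesis using that by auto
qed

text \<open>A second copy of the link would be a second link with the same output. Links without
  outputs escape this argument.\<close>

lemma is_net_count:
  assumes "is_net S" "l \<in># links S" "target l \<noteq> []"
  shows "count (links S) l = 1"
proof -
  obtain p where p: "p \<in> set (target l)" using assms(3) by (cases "target l") auto
  have "count {#l \<in># links S. p \<in> set (target l)#} l \<le> size {#l \<in># links S. p \<in> set (target l)#}"
    by (rule count_le_size)
  also have "\<dots> = 1"
    using is_net_size_target[OF assms(1) in_positionsI(2)[OF assms(2) p]] .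
  finally have "count (links S) l \<le> 1" using p by simp
  moreover have "count (links S) l > 0" using assms(2) by simp
  ultimately show ?thesis by linarith
qed

section \<open>Permutation of conclusions\<close>

lemma typeable_swap:
  assumes "typeable dual (Net N (cs @ [p, q] @ ds)) (map \<tau> (cs @ [p, q] @ ds))"
  shows "typeable dual (Net N (cs @ [q, p] @ ds)) (map \<tau> (cs @ [q, p] @ ds))"
proof -
  obtain \<pi> where \<pi>: "derives dual \<pi> (map \<tau> cs @ [\<tau> p, \<tau> q] @ map \<tau> ds)"
      "represents (Net N (cs @ [p, q] @ ds)) \<pi>"
    using assms by (auto simp: typeable_def)
  show ?thesis
    using derives_ex[OF \<pi>(1)] represents_ex[OF \<pi>(2)] by (auto simp: typeable_def)
qed

lemma typeable_move:
  assumes "typeable dual (Net N (cs @ xs @ x # ds)) (map \<tau> (cs @ xs @ x # ds))"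
  shows "typeable dual (Net N (cs @ x # xs @ ds)) (map \<tau> (cs @ x # xs @ ds))"
  using assms
proof (induction xs arbitrary: ds rule: rev_induct)
  case (snoc z xs)
  then show ?case using typeable_swap[of dual N "cs @ xs" z x ds \<tau>] snoc.IH[of "z # ds"] by simp
qed simp

text \<open>Exchanges of neighbours generate all permutations. Reading the formulas off a fixed
  labelling \<open>\<tau>\<close> makes the sequent follow the order of the conclusions by
  itself.\<close>

lemma typeable_permute:
  assumes "typeable dual (Net N (cs @ xs)) (map \<tau> (cs @ xs))" "mset xs = mset ys"
  shows "typeable dual (Net N (cs @ ys)) (map \<tau> (cs @ ys))"
  using assms
proof (induction ys arbitrary: cs xs)
  case (Cons y ys)
  then obtain us vs where xs: "xs = us @ y # vs"
    using split_list[of y xs] mset_eq_setD[OF Cons.prems(2)] by auto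
  show ?case
    using Cons.IH[of "cs @ [y]" "us @ vs"] Cons.prems typeable_move[of dual N cs us y vs \<tau>]
    by (simp add: xs)
qed simp

section \<open>Switchings of trees\<close>

text \<open>\<open>c\<close> is the class of the component containing the root, \<open>D\<close> collects the other classes.\<close>

inductive switched :: "'p ctree \<Rightarrow> 'p set \<Rightarrow> 'p set set \<Rightarrow> bool" where
  switched_leaf: "switched (Leaf p) {p} {}"
| switched_tensor: "switched a c\<^sub>1 D\<^sub>1 \<Longrightarrow> switched b c\<^sub>2 D\<^sub>2 \<Longrightarrow>
    switched (Node False p a b) (c\<^sub>1 \<union> c\<^sub>2) (D\<^sub>1 \<union> D\<^sub>2)"
| switched_left: "switched a c\<^sub>1 D\<^sub>1 \<Longrightarrow> switched b c\<^sub>2 D\<^sub>2 \<Longrightarrow>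
    switched (Node True p a b) c\<^sub>1 (insert c\<^sub>2 (D\<^sub>1 \<union> D\<^sub>2))"
| switched_right: "switched a c\<^sub>1 D\<^sub>1 \<Longrightarrow> switched b c\<^sub>2 D\<^sub>2 \<Longrightarrow>
    switched (Node True p a b) c\<^sub>2 (insert c\<^sub>1 (D\<^sub>1 \<union> D\<^sub>2))"

text \<open>The rules only form singletons, unions and insertions, which commute with taking
  images.\<close>

lemma switched_map:
  "switched s c D \<Longrightarrow> switched (map_ctree \<phi> s) (\<phi> ` c) ((`) \<phi> ` D)"
  by (induction rule: switched.induct) (simp_all add: image_Un switched.intros)

text \<open>Each node keeps at least one branch, so every component contains a leaf. This later
  excludes daimon links without outputs from a test.\<close>

lemma switched_classes:
  assumes "switched s c D"
  shows "finite D" "{} \<notin> insert c D" "\<Union> (insert c D) = set (leaves s)"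
  using assms by (induction rule: switched.induct) auto

lemma switched_class_subset:
  "switched s c D \<Longrightarrow> X \<in> insert c D \<Longrightarrow> X \<subseteq> set (nodes s) \<and> X \<noteq> {}"
  using switched_classes(2,3)[of s c D] leaves_subset_nodes[of s] by blast

text \<open>Nonempty classes over disjoint sets of nodes differ. Thus unions of sets of classes
  become sums of multisets of daimon links.\<close>

lemma switched_disjoint:
  assumes "switched a c\<^sub>1 D\<^sub>1" "switched b c\<^sub>2 D\<^sub>2" "set (nodes a) \<inter> set (nodes b) = {}"
  shows "insert c\<^sub>1 D\<^sub>1 \<inter> insert c\<^sub>2 D\<^sub>2 = {}"
proof (rule ccontr)
  assume "\<not> ?thesis"
  then obtain X where "X \<in> insert c\<^sub>1 D\<^sub>1" "X \<in> insert c\<^sub>2 D\<^sub>2" by blast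
  then have "X \<subseteq> set (nodes a)" "X \<subseteq> set (nodes b)" "X \<noteq> {}"
    using switched_class_subset[OF assms(1)] switched_class_subset[OF assms(2)] by metis+
  then show False using assms(3) by blast
qed

text \<open>Since classes are kept in a set, a coincidence would lose a daimon link. At a tensor,
  the root class meets both subtrees, whereas every other class lies within one of them.\<close>

lemma switched_root_class_notin:
  "switched s c D \<Longrightarrow> distinct (nodes s) \<Longrightarrow> c \<notin> D"
proof (induction rule: switched.induct)
  case (switched_tensor a c\<^sub>1 D\<^sub>1 b c\<^sub>2 D\<^sub>2 p)
  have dis: "set (nodes a) \<inter> set (nodes b) = {}"
    using switched_tensor.prems by simp
  have c: "c\<^sub>1 \<subseteq> set (nodes a)" "c\<^sub>1 \<noteq> {}" "c\<^sub>2 \<subseteq> set (nodes b)" "c\<^sub>2 \<noteq> {}"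
    using switched_tensor.hyps switched_class_subset by blast+
  show ?case
  proof
    assume "c\<^sub>1 \<union> c\<^sub>2 \<in> D\<^sub>1 \<union> D\<^sub>2"
    then have "c\<^sub>1 \<union> c\<^sub>2 \<subseteq> set (nodes a) \<or> c\<^sub>1 \<union> c\<^sub>2 \<subseteq> set (nodes b)"
      using switched_class_subset[OF switched_tensor.hyps(1), of "c\<^sub>1 \<union> c\<^sub>2"]
        switched_class_subset[OF switched_tensor.hyps(2), of "c\<^sub>1 \<union> c\<^sub>2"] by auto
    then show False using c dis by blast
  qed
next
  case (switched_left a c\<^sub>1 D\<^sub>1 b c\<^sub>2 D\<^sub>2 p)
  then show ?case using switched_disjoint[of a c\<^sub>1 D\<^sub>1 b c\<^sub>2 D\<^sub>2] by auto
next
  case (switched_right a c\<^sub>1 D\<^sub>1 b c\<^sub>2 D\<^sub>2 p)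
  then show ?case using switched_disjoint[of a c\<^sub>1 D\<^sub>1 b c\<^sub>2 D\<^sub>2] by auto
qed simp

section \<open>Sequentialization\<close>

lemma positions_Net_plus:
  "positions (Net (M + N) cs) = positions (Net M cs) \<union> positions (Net N cs)"
  by (auto simp: positions_def)

lemma positions_Net_concl: "positions (Net M cs) = positions (Net M [])"
  by (auto simp: positions_def)

lemma positions_Net_add_mset:
  "positions (Net (add_mset l M) cs) = set (source l) \<union> set (target l) \<union> positions (Net M cs)"
  by (auto simp: positions_def)

lemma positions_clinks: "positions (Net (clinks t) cs) \<subseteq> set (nodes t)"
proof (induction t)
  case (Leaf p)
  then show ?case by (simp add: positions_def)
next
  case (Node k p a b)
  then show ?case
    by (simp add: positions_Net_add_mset positions_Net_plus) blast
qed

text \<open>A daimon link lists its outputs in an order that its class does not record;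
  \<open>enum\<close> supplies it, so that the daimons of a given net can be matched
  exactly.\<close>

abbreviation daimons :: "('p set \<Rightarrow> 'p list) \<Rightarrow> 'p set set \<Rightarrow> 'p link multiset" where
  "daimons enum D \<equiv> image_mset (\<lambda>X. DaimonLink (enum X)) (mset_set D)"

lemma positions_daimons:
  assumes "finite D" "\<And>X. X \<in> D \<Longrightarrow> set (enum X) = X"
  shows "positions (Net (daimons enum D) cs) = \<Union> D"
  using assms by (auto simp: positions_def)

lemma typeable_daimon: "distinct ps \<Longrightarrow> typeable dual (Net {#DaimonLink ps#} ps) (map \<tau> ps)"
  using derives_daimon[of dual "map \<tau> ps"] represents_daimon[of ps "map \<tau> ps"]
  unfolding typeable_def by auto

lemma typeable_par:
  assumes "typeable dual (Net N (cs @ [p\<^sub>1, p\<^sub>2])) (map \<tau> (cs @ [p\<^sub>1, p\<^sub>2]))"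
    and "p \<notin> positions (Net N [])" "\<tau> p = Par (\<tau> p\<^sub>1) (\<tau> p\<^sub>2)"
  shows "typeable dual (Net (N + {#ParLink p\<^sub>1 p\<^sub>2 p#}) (cs @ [p])) (map \<tau> (cs @ [p]))"
proof -
  obtain \<pi> where \<pi>: "derives dual \<pi> (map \<tau> cs @ [\<tau> p\<^sub>1, \<tau> p\<^sub>2])"
      "represents (Net N (cs @ [p\<^sub>1, p\<^sub>2])) \<pi>"
    using assms by (auto simp: typeable_def)
  show ?thesis
    using derives_par[OF \<pi>(1)] represents_par[OF \<pi>(2), of p] assms(2,3)
    by (auto simp: typeable_def positions_Net_concl[of N "_ @ _"])
qed

lemma typeable_tensor:
  assumes "typeable dual (Net N (cs @ [p\<^sub>1])) (map \<tau> (cs @ [p\<^sub>1]))"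
    and "typeable dual (Net M (ds @ [p\<^sub>2])) (map \<tau> (ds @ [p\<^sub>2]))"
    and "positions (Net N []) \<inter> positions (Net M []) = {}"
    and "p \<notin> positions (Net N []) \<union> positions (Net M [])"
    and "\<tau> p = Tensor (\<tau> p\<^sub>1) (\<tau> p\<^sub>2)"
  shows "typeable dual (Net (N + M + {#TensorLink p\<^sub>1 p\<^sub>2 p#}) (cs @ ds @ [p]))
           (map \<tau> (cs @ ds @ [p]))"
proof -
  obtain \<pi>\<^sub>1 \<pi>\<^sub>2 where \<pi>: "derives dual \<pi>\<^sub>1 (map \<tau> cs @ [\<tau> p\<^sub>1])" "represents (Net N (cs @ [p\<^sub>1])) \<pi>\<^sub>1"
      "derives dual \<pi>\<^sub>2 (map \<tau> ds @ [\<tau> p\<^sub>2])" "represents (Net M (ds @ [p\<^sub>2])) \<pi>\<^sub>2"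
    using assms by (auto simp: typeable_def)
  show ?thesis
    using derives_tensor[OF \<pi>(1,3)] represents_tensor[OF \<pi>(2,4), of p] assms(3-5)
    by (auto simp: typeable_def positions_Net_concl[of _ "_ @ _"])
qed

lemma switched_positions:
  assumes "switched s c D" "\<And>X. X \<in> D \<Longrightarrow> set (enum X) = X"
  shows "positions (Net (N + clinks (flip s) + daimons enum D) cs)
           \<subseteq> positions (Net N []) \<union> set (nodes s)"
proof -
  have "\<Union> D \<subseteq> set (nodes s)"
    using switched_classes(3)[OF assms(1)] leaves_subset_nodes[of s] by auto
  moreover have "positions (Net (daimons enum D) cs) = \<Union> D"
    using positions_daimons switched_classes(1)[OF assms(1)] assms(2) by blast
  moreover have "positions (Net (clinks (flip s)) cs) \<subseteq> set (nodes s)"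
    using positions_clinks[of "flip s"] by simp
  moreover have "positions (Net N cs) = positions (Net N [])"
    by (rule positions_Net_concl)
  ultimately show ?thesis unfolding positions_Net_plus by blast
qed

text \<open>
  Gluing a tree onto a net along the root class of a switching of the dual tree: a tensor of the
  switched tree becomes a par, both of whose premises are glued onto the same net; a par becomes
  a tensor, whose dropped premise is glued onto a daimon of its own.
\<close>

lemma typeable_switched:
  assumes "switched s c D" "distinct (nodes s)"
    and "\<And>X. X \<in> D \<Longrightarrow> distinct (enum X) \<and> set (enum X) = X"
    and "formula_labelling (Net (clinks (flip s)) []) \<tau>"
    and "typeable dual (Net N (cs @ ls)) (map \<tau> (cs @ ls))" "distinct ls" "set ls = c"
    and "positions (Net N []) \<inter> set (nodes s) = c"
  shows "typeable dual (Net (N + clinks (flip s) + daimons enum D) (cs @ [root s]))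
           (map \<tau> (cs @ [root s]))"
  using assms
proof (induction arbitrary: N cs ls rule: switched.induct)
  case (switched_leaf p)
  then have "mset ls = mset [p]"
    by (subst set_eq_iff_mset_eq_distinct[symmetric]) auto
  then have "ls = [p]" by simp
  then show ?case using switched_leaf by simp
next
  case (switched_tensor a c\<^sub>1 D\<^sub>1 b c\<^sub>2 D\<^sub>2 p)
  note prems = switched_tensor.prems and hyps = switched_tensor.hyps and IH = switched_tensor.IH
  have fin: "finite D\<^sub>1" "finite D\<^sub>2"
    using hyps switched_classes(1) by blast+
  have sub: "c\<^sub>1 \<subseteq> set (nodes a)" "c\<^sub>2 \<subseteq> set (nodes b)"
    using switched_class_subset[OF hyps(1)] switched_class_subset[OF hyps(2)] by simp_all
  have dis: "set (nodes a) \<inter> set (nodes b) = {}" "distinct (nodes a)" "distinct (nodes b)"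
      "p \<notin> set (nodes a)" "p \<notin> set (nodes b)" "set (nodes (Node False p a b)) = insert p (set (nodes a) \<union> set (nodes b))"
    using prems(1) by auto
  have enum: "X \<in> D\<^sub>1 \<Longrightarrow> distinct (enum X) \<and> set (enum X) = X"
      "X \<in> D\<^sub>2 \<Longrightarrow> distinct (enum X) \<and> set (enum X) = X" for X
    using prems(2) by blast+
  have lab: "formula_labelling (Net (clinks (flip a)) []) \<tau>"
      "formula_labelling (Net (clinks (flip b)) []) \<tau>"
      "\<tau> p = Par (\<tau> (root a)) (\<tau> (root b))"
    using prems(3) by (auto simp: formula_labelling_def)
  have D: "daimons enum (D\<^sub>1 \<union> D\<^sub>2) = daimons enum D\<^sub>1 + daimons enum D\<^sub>2"
    using switched_disjoint[OF hyps dis(1)] fin by (simp add: mset_set_Union)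
  have pos: "positions (Net (N' + clinks (flip a) + daimons enum D\<^sub>1) [])
        \<subseteq> positions (Net N' []) \<union> set (nodes a)"
      "positions (Net (N' + clinks (flip b) + daimons enum D\<^sub>2) [])
        \<subseteq> positions (Net N' []) \<union> set (nodes b)" for N'
    using switched_positions[OF hyps(1), of enum N' "[]"] switched_positions[OF hyps(2), of enum N' "[]"] enum
    by blast+
  let ?N = "N + clinks (flip a) + daimons enum D\<^sub>1"
  let ?M = "?N + clinks (flip b) + daimons enum D\<^sub>2"
  have "finite c\<^sub>1" "finite c\<^sub>2" using sub finite_subset by blast+
  then obtain l\<^sub>1 l\<^sub>2 where l: "set l\<^sub>1 = c\<^sub>1" "distinct l\<^sub>1" "set l\<^sub>2 = c\<^sub>2" "distinct l\<^sub>2"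
    using finite_distinct_list by metis
  have "set l\<^sub>2 \<inter> set l\<^sub>1 = {}" using l sub dis(1) by blast
  \<comment> \<open>The class is split so that \<open>l\<^sub>2\<close> waits in the context while
    \<open>a\<close> is glued onto \<open>l\<^sub>1\<close>; afterwards \<open>root a\<close> waits
    while \<open>b\<close> is glued onto \<open>l\<^sub>2\<close>.\<close>
  then have "mset ls = mset (l\<^sub>2 @ l\<^sub>1)"
    using prems(5,6) l by (subst set_eq_iff_mset_eq_distinct[symmetric]) auto
  from typeable_permute[OF prems(4) this]
  have 1: "typeable dual (Net N ((cs @ l\<^sub>2) @ l\<^sub>1)) (map \<tau> ((cs @ l\<^sub>2) @ l\<^sub>1))"
    by simp
  have "positions (Net N []) \<inter> set (nodes a) = c\<^sub>1"
    using prems(7) sub dis(1,6) by blast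
  from IH(1)[OF dis(2) enum(1) lab(1) 1 l(2,1) this]
  have "typeable dual (Net ?N (cs @ (l\<^sub>2 @ [root a]))) (map \<tau> (cs @ (l\<^sub>2 @ [root a])))"
    by simp
  then have "typeable dual (Net ?N (cs @ ([root a] @ l\<^sub>2))) (map \<tau> (cs @ ([root a] @ l\<^sub>2)))"
    by (rule typeable_permute) simp
  then have 2: "typeable dual (Net ?N ((cs @ [root a]) @ l\<^sub>2)) (map \<tau> ((cs @ [root a]) @ l\<^sub>2))"
    by simp
  have "positions (Net N []) \<subseteq> positions (Net ?N [])"
    unfolding positions_Net_plus by blast
  \<comment> \<open>Gluing \<open>a\<close> adds only nodes of \<open>a\<close>, so the net still
    meets \<open>b\<close> exactly in \<open>c\<^sub>2\<close>.\<close>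
  then have "positions (Net ?N []) \<inter> set (nodes b) = c\<^sub>2"
    using prems(7) sub dis(1,6) pos(1)[of N] by blast
  from IH(2)[OF dis(3) enum(2) lab(2) 2 l(4,3) this]
  have 3: "typeable dual (Net ?M (cs @ [root a, root b])) (map \<tau> (cs @ [root a, root b]))"
    by simp
  have "p \<notin> positions (Net ?M [])"
    using pos(1)[of N] pos(2)[of ?N] dis(4-6) prems(7) sub by blast
  from typeable_par[OF 3 this lab(3)] show ?case
    by (simp add: D add_ac)
next
  case (switched_left a c\<^sub>1 D\<^sub>1 b c\<^sub>2 D\<^sub>2 p)
  note prems = switched_left.prems and hyps = switched_left.hyps and IH = switched_left.IH
  have fin: "finite D\<^sub>1" "finite D\<^sub>2"
    using hyps switched_classes(1) by blast+
  have sub: "c\<^sub>1 \<subseteq> set (nodes a)" "c\<^sub>2 \<subseteq> set (nodes b)"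
    using switched_class_subset[OF hyps(1)] switched_class_subset[OF hyps(2)] by simp_all
  have dis: "set (nodes a) \<inter> set (nodes b) = {}" "distinct (nodes a)" "distinct (nodes b)"
      "p \<notin> set (nodes a)" "p \<notin> set (nodes b)" "set (nodes (Node True p a b)) = insert p (set (nodes a) \<union> set (nodes b))"
    using prems(1) by auto
  have enum: "X \<in> D\<^sub>1 \<Longrightarrow> distinct (enum X) \<and> set (enum X) = X"
      "X \<in> D\<^sub>2 \<Longrightarrow> distinct (enum X) \<and> set (enum X) = X" for X
    using prems(2) by blast+
  have lab: "formula_labelling (Net (clinks (flip a)) []) \<tau>"
      "formula_labelling (Net (clinks (flip b)) []) \<tau>"
      "\<tau> p = Tensor (\<tau> (root a)) (\<tau> (root b))"
    using prems(3) by (auto simp: formula_labelling_def)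
  have D: "daimons enum (D\<^sub>1 \<union> D\<^sub>2) = daimons enum D\<^sub>1 + daimons enum D\<^sub>2"
    using switched_disjoint[OF hyps dis(1)] fin by (simp add: mset_set_Union)
  have pos: "positions (Net (N' + clinks (flip a) + daimons enum D\<^sub>1) [])
        \<subseteq> positions (Net N' []) \<union> set (nodes a)"
      "positions (Net (N' + clinks (flip b) + daimons enum D\<^sub>2) [])
        \<subseteq> positions (Net N' []) \<union> set (nodes b)" for N'
    using switched_positions[OF hyps(1), of enum N' "[]"] switched_positions[OF hyps(2), of enum N' "[]"] enum
    by blast+
  have "c\<^sub>2 \<notin> D\<^sub>1 \<union> D\<^sub>2"
    using switched_disjoint[OF hyps dis(1)] switched_root_class_notin[OF hyps(2) dis(3)] by blast
  then have D': "daimons enum (insert c\<^sub>2 (D\<^sub>1 \<union> D\<^sub>2)) =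
      add_mset (DaimonLink (enum c\<^sub>2)) (daimons enum D\<^sub>1 + daimons enum D\<^sub>2)"
    using fin by (simp add: D)
  have enum_c: "distinct (enum c\<^sub>2)" "set (enum c\<^sub>2) = c\<^sub>2"
    using prems(2) by auto
  let ?N = "N + clinks (flip a) + daimons enum D\<^sub>1"
  let ?M = "{#DaimonLink (enum c\<^sub>2)#} + clinks (flip b) + daimons enum D\<^sub>2"
  have "positions (Net N []) \<inter> set (nodes a) = c\<^sub>1"
    using prems(7) sub dis(1,6) by blast
  note 1 = IH(1)[OF dis(2) enum(1) lab(1) prems(4-6) this]
  \<comment> \<open>The context is empty because \<open>b\<close> consumes all outputs of this
    daimon: the second premise of the tensor rule has \<open>root b\<close> as its only
    conclusion.\<close>
  have 2: "typeable dual (Net {#DaimonLink (enum c\<^sub>2)#} ([] @ enum c\<^sub>2)) (map \<tau> ([] @ enum c\<^sub>2))"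
    using typeable_daimon[OF enum_c(1)] by simp
  have P: "positions (Net {#DaimonLink (enum c\<^sub>2)#} []) = c\<^sub>2"
    by (simp add: positions_def enum_c)
  then have "positions (Net {#DaimonLink (enum c\<^sub>2)#} []) \<inter> set (nodes b) = c\<^sub>2"
    using sub by blast
  note 2 = IH(2)[OF dis(3) enum(2) lab(2) 2 enum_c this]
  have PM: "positions (Net ?M []) \<subseteq> set (nodes b)"
    using pos(2)[of "{#DaimonLink (enum c\<^sub>2)#}"] P sub by blast
  have PN: "positions (Net ?N []) \<subseteq> positions (Net N []) \<union> set (nodes a)"
    by (rule pos(1))
  have N: "positions (Net N []) \<inter> set (nodes b) = {}" "p \<notin> positions (Net N [])"
    using prems(7) sub dis(1,4-6) by blast+
  have 3: "positions (Net ?N []) \<inter> positions (Net ?M []) = {}"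
      "p \<notin> positions (Net ?N []) \<union> positions (Net ?M [])"
    using PM PN N dis(1,4,5) by blast+
  from typeable_tensor[OF 1 2 3 lab(3)] show ?case
    by (simp add: D' add_ac)
next
  case (switched_right a c\<^sub>1 D\<^sub>1 b c\<^sub>2 D\<^sub>2 p)
  note prems = switched_right.prems and hyps = switched_right.hyps and IH = switched_right.IH
  have fin: "finite D\<^sub>1" "finite D\<^sub>2"
    using hyps switched_classes(1) by blast+
  have sub: "c\<^sub>1 \<subseteq> set (nodes a)" "c\<^sub>2 \<subseteq> set (nodes b)"
    using switched_class_subset[OF hyps(1)] switched_class_subset[OF hyps(2)] by simp_all
  have dis: "set (nodes a) \<inter> set (nodes b) = {}" "distinct (nodes a)" "distinct (nodes b)"
      "p \<notin> set (nodes a)" "p \<notin> set (nodes b)" "set (nodes (Node True p a b)) = insert p (set (nodes a) \<union> set (nodes b))"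
    using prems(1) by auto
  have enum: "X \<in> D\<^sub>1 \<Longrightarrow> distinct (enum X) \<and> set (enum X) = X"
      "X \<in> D\<^sub>2 \<Longrightarrow> distinct (enum X) \<and> set (enum X) = X" for X
    using prems(2) by blast+
  have lab: "formula_labelling (Net (clinks (flip a)) []) \<tau>"
      "formula_labelling (Net (clinks (flip b)) []) \<tau>"
      "\<tau> p = Tensor (\<tau> (root a)) (\<tau> (root b))"
    using prems(3) by (auto simp: formula_labelling_def)
  have D: "daimons enum (D\<^sub>1 \<union> D\<^sub>2) = daimons enum D\<^sub>1 + daimons enum D\<^sub>2"
    using switched_disjoint[OF hyps dis(1)] fin by (simp add: mset_set_Union)
  have pos: "positions (Net (N' + clinks (flip a) + daimons enum D\<^sub>1) [])
        \<subseteq> positions (Net N' []) \<union> set (nodes a)"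
      "positions (Net (N' + clinks (flip b) + daimons enum D\<^sub>2) [])
        \<subseteq> positions (Net N' []) \<union> set (nodes b)" for N'
    using switched_positions[OF hyps(1), of enum N' "[]"] switched_positions[OF hyps(2), of enum N' "[]"] enum
    by blast+
  have "c\<^sub>1 \<notin> D\<^sub>1 \<union> D\<^sub>2"
    using switched_disjoint[OF hyps dis(1)] switched_root_class_notin[OF hyps(1) dis(2)] by blast
  then have D': "daimons enum (insert c\<^sub>1 (D\<^sub>1 \<union> D\<^sub>2)) =
      add_mset (DaimonLink (enum c\<^sub>1)) (daimons enum D\<^sub>1 + daimons enum D\<^sub>2)"
    using fin by (simp add: D)
  have enum_c: "distinct (enum c\<^sub>1)" "set (enum c\<^sub>1) = c\<^sub>1"
    using prems(2) by auto
  let ?N = "N + clinks (flip b) + daimons enum D\<^sub>2"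
  let ?M = "{#DaimonLink (enum c\<^sub>1)#} + clinks (flip a) + daimons enum D\<^sub>1"
  have "positions (Net N []) \<inter> set (nodes b) = c\<^sub>2"
    using prems(7) sub dis(1,6) by blast
  note 1 = IH(2)[OF dis(3) enum(2) lab(2) prems(4-6) this]
  have 2: "typeable dual (Net {#DaimonLink (enum c\<^sub>1)#} ([] @ enum c\<^sub>1)) (map \<tau> ([] @ enum c\<^sub>1))"
    using typeable_daimon[OF enum_c(1)] by simp
  have P: "positions (Net {#DaimonLink (enum c\<^sub>1)#} []) = c\<^sub>1"
    by (simp add: positions_def enum_c)
  then have "positions (Net {#DaimonLink (enum c\<^sub>1)#} []) \<inter> set (nodes a) = c\<^sub>1"
    using sub by blast
  note 2 = IH(1)[OF dis(2) enum(1) lab(1) 2 enum_c this]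
  have PM: "positions (Net ?M []) \<subseteq> set (nodes a)"
    using pos(1)[of "{#DaimonLink (enum c\<^sub>1)#}"] P sub by blast
  have PN: "positions (Net ?N []) \<subseteq> positions (Net N []) \<union> set (nodes b)"
    by (rule pos(2))
  have N: "positions (Net N []) \<inter> set (nodes a) = {}" "p \<notin> positions (Net N [])"
    using prems(7) sub dis(1,4-6) by blast+
  have 3: "positions (Net ?M []) \<inter> positions (Net ?N []) = {}"
      "p \<notin> positions (Net ?M []) \<union> positions (Net ?N [])"
    using PM PN N dis(1,4,5) by blast+
  \<comment> \<open>The first premise must end in \<open>root a\<close>, so the daimon side comes
    first here. Its context is empty, hence the order of the conclusions is already right.\<close>
  from typeable_tensor[OF 2 1 3 lab(3)] show ?case
    by (simp add: D' add_ac)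
qed

section \<open>The tree of a cut-free net\<close>

text \<open>Only supports are compared, which suffices for following links; multiplicities are
  settled in \<open>tree_net_links\<close>. Initial leaves force the tree to extend all the way up
  to the daimons.\<close>

definition tree_in :: "'p net \<Rightarrow> 'p ctree \<Rightarrow> bool" where
  "tree_in S t \<longleftrightarrow> set_mset (clinks t) \<subseteq> set_mset (links S) \<and> set (leaves t) \<subseteq> initials S"

lemma tree_in_Leaf [simp]: "tree_in S (Leaf p) \<longleftrightarrow> p \<in> initials S"
  by (simp add: tree_in_def)

lemma tree_in_Node [simp]:
  "tree_in S (Node k p a b) \<longleftrightarrow>
     conn k (root a) (root b) p \<in># links S \<and> tree_in S a \<and> tree_in S b"
  by (auto simp: tree_in_def)

lemma formula_labelling_conn:
  assumes "formula_labelling S \<tau>" "conn k a b p \<in># links S"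
  shows "\<tau> p = (if k then Par (\<tau> a) (\<tau> b) else Tensor (\<tau> a) (\<tau> b))"
  using assms by (cases k) (auto simp: formula_labelling_def)

lemma initials_iff: "p \<in> initials S \<longleftrightarrow> (\<exists>ps. DaimonLink ps \<in># links S \<and> p \<in> set ps)"
  by (simp add: initials_def)

lemma initials_subset_positions: "initials S \<subseteq> positions S"
  using in_positionsI(2)[of "DaimonLink _" S] by (auto simp: initials_iff)

lemma initial_not_conn_target:
  assumes "is_net S" "p \<in> initials S"
  shows "conn k a b p \<notin># links S"
proof
  assume c: "conn k a b p \<in># links S"
  obtain ps where "DaimonLink ps \<in># links S" "p \<in> set ps"
    using assms(2) unfolding initials_iff by blast
  then show False using is_net_target_unique[OF assms(1) c, of "DaimonLink ps" p] by simp
qed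

lemma in_conn_target_cases:
  assumes "is_net S" "p \<in> positions S"
  obtains "p \<in> initials S" | k a b where "conn k a b p \<in># links S"
proof -
  obtain l where l: "l \<in># links S" "p \<in> set (target l)"
    using is_net_target_ex[OF assms] .
  show ?thesis
  proof (cases l rule: link_cases)
    case (conn k a b q)
    then show ?thesis using l that(2) by auto
  next
    case (cut a b)
    then show ?thesis using l by simp
  next
    case (daimon ps)
    then show ?thesis using l that(1) unfolding initials_iff by auto
  qed
qed

text \<open>The climb from \<open>x\<close> ends because the label of an input is a proper
  subformula of the label of the output. Atomicity makes the shape of the formula stop exactly where
  the tree does.\<close>

lemma ex_tree_in:
  assumes net: "is_net S" and lab: "atomic_labelling S \<tau>" and "x \<in> positions S"
  shows "\<exists>t. root t = x \<and> tree_in S t \<and> fits t (\<tau> x)"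
  using assms(3)
proof (induction "size (\<tau> x)" arbitrary: x rule: less_induct)
  case less
  have fl: "formula_labelling S \<tau>" using lab by (simp add: atomic_labelling_def)
  from net less.prems show ?case
  proof (cases rule: in_conn_target_cases)
    case 1
    then obtain X where "\<tau> x = Var X" using lab unfolding atomic_labelling_def by blast
    then show ?thesis using 1 by (intro exI[of _ "Leaf x"]) simp
  next
    case (2 k a b)
    have x: "\<tau> x = (if k then Par (\<tau> a) (\<tau> b) else Tensor (\<tau> a) (\<tau> b))"
      using formula_labelling_conn[OF fl 2] .
    have pos: "a \<in> positions S" "b \<in> positions S"
      using in_positionsI(1)[OF 2] by simp_all
    obtain t\<^sub>1 where t\<^sub>1: "root t\<^sub>1 = a" "tree_in S t\<^sub>1" "fits t\<^sub>1 (\<tau> a)"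
      using less.hyps[OF _ pos(1)] x by (cases k) auto
    obtain t\<^sub>2 where t\<^sub>2: "root t\<^sub>2 = b" "tree_in S t\<^sub>2" "fits t\<^sub>2 (\<tau> b)"
      using less.hyps[OF _ pos(2)] x by (cases k) auto
    show ?thesis
      using t\<^sub>1 t\<^sub>2 2 x by (intro exI[of _ "Node k x t\<^sub>1 t\<^sub>2"]) (cases k; simp)
  qed
qed

section \<open>The flow from inputs to outputs: acyclic and single-valued\<close>

lemma flow_cut_freeE:
  assumes "cut_free S" "(x, y) \<in> flow S"
  obtains k a b where "conn k a b y \<in># links S" "x \<in> {a, b}"
proof -
  obtain l where l: "l \<in># links S" "x \<in> set (source l)" "y \<in> set (target l)"
    using assms(2) by (auto simp: flow_def)
  show ?thesis
    by (cases l rule: link_cases) (use l that in auto)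
qed

lemma flow_size:
  assumes "cut_free S" "formula_labelling S \<tau>" "(x, y) \<in> flow S"
  shows "size (\<tau> x) < size (\<tau> y)"
  using assms(1,3)
proof (cases rule: flow_cut_freeE)
  case (1 k a b)
  then show ?thesis using formula_labelling_conn[OF assms(2) 1(1)] by (cases k) auto
qed

lemma flow_rtrancl_size:
  assumes "cut_free S" "formula_labelling S \<tau>" "(x, y) \<in> (flow S)\<^sup>*"
  shows "size (\<tau> x) \<le> size (\<tau> y)"
  using assms(3) by (induction rule: rtrancl_induct) (use flow_size[OF assms(1,2)] in fastforce)+

lemma single_valued_flow:
  assumes "is_net S" "cut_free S"
  shows "single_valued (flow S)"
proof (rule single_valuedI)
  fix x y z
  assume xy: "(x, y) \<in> flow S" and xz: "(x, z) \<in> flow S"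
  from assms(2) xy show "y = z"
  proof (cases rule: flow_cut_freeE)
    case (1 k a b)
    note l = 1
    from assms(2) xz show ?thesis
    proof (cases rule: flow_cut_freeE)
      case (1 k' a' b')
      have "conn k a b y = conn k' a' b' z"
        by (rule is_net_source_unique[OF assms(1) l(1) 1(1), of x]) (use l(2) 1(2) in auto)
      then show ?thesis by simp
    qed
  qed
qed

lemma conn_flow:
  assumes "conn k a b p \<in># links S"
  shows "(a, p) \<in> flow S" "(b, p) \<in> flow S"
  using assms unfolding flow_def by (auto intro!: bexI[of _ "conn k a b p"])

lemma nodes_flow: "tree_in S t \<Longrightarrow> y \<in> set (nodes t) \<Longrightarrow> (y, root t) \<in> (flow S)\<^sup>*"
proof (induction t)
  case (Node k p a b)
  have "conn k (root a) (root b) p \<in># links S" using Node.prems by simp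
  note conn_flow[OF this]
  then show ?case using Node by (auto intro: rtrancl_into_rtrancl)
qed simp

text \<open>A node common to both subtrees would flow to both roots. As the flow is single-valued,
  one root would flow to the other, necessarily through their common output \<open>p\<close>; but
  \<open>p\<close> has a larger label than either root.\<close>

lemma distinct_nodes:
  assumes "is_net S" "cut_free S" "formula_labelling S \<tau>" "tree_in S t"
  shows "distinct (nodes t)"
  using assms(4)
proof (induction t)
  case (Node k p a b)
  let ?a = "root a" and ?b = "root b"
  have c: "conn k ?a ?b p \<in># links S" and ta: "tree_in S a" "tree_in S b" using Node.prems by simp_all
  note fl = conn_flow[OF c] and sz = flow_size[OF assms(2,3)] flow_rtrancl_size[OF assms(2,3)]
    and sv = single_valued_flow[OF assms(1,2)]
  have "p \<notin> set (nodes a)" "p \<notin> set (nodes b)"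
    using nodes_flow[OF ta(1), of p] nodes_flow[OF ta(2), of p] sz(1)[OF fl(1)] sz(1)[OF fl(2)]
      sz(2)[of p ?a] sz(2)[of p ?b] by auto
  moreover have "set (nodes a) \<inter> set (nodes b) = {}"
  proof (rule ccontr)
    assume "\<not> ?thesis"
    then obtain y where "(y, ?a) \<in> (flow S)\<^sup>*" "(y, ?b) \<in> (flow S)\<^sup>*"
      using nodes_flow[OF ta(1)] nodes_flow[OF ta(2)] by blast
    then have "(?a, ?b) \<in> (flow S)\<^sup>* \<or> (?b, ?a) \<in> (flow S)\<^sup>*"
      using single_valued_confluent[OF sv] by blast
    moreover have "?a \<noteq> ?b"
      using c assms(1) unfolding is_net_def by force
    moreover have False if xy: "(x, y) \<in> (flow S)\<^sup>*" "x \<noteq> y" "(x, p) \<in> flow S" "(y, p) \<in> flow S" for x y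
    proof -
      obtain z where z: "(x, z) \<in> flow S" "(z, y) \<in> (flow S)\<^sup>*"
        using xy(1,2) by (meson converse_rtranclE)
      then have "z = p" using sv xy(3) by (meson single_valuedD)
      then show False using sz(2)[OF z(2)] sz(1)[OF xy(4)] by simp
    qed
    ultimately show False using fl by metis
  qed
  ultimately show ?case using Node.IH ta by simp
qed simp

lemma finite_positions: "finite (positions S)"
  by (simp add: positions_def)

lemma nodes_subset_positions: "tree_in S t \<Longrightarrow> set (nodes t) \<subseteq> positions S"
proof (induction t)
  case (Leaf p)
  then show ?case using initials_subset_positions[of S] by auto
next
  case (Node k p a b)
  then show ?case using in_positionsI(2)[of "conn k (root a) (root b) p" S p] by simp
qed

text \<open>The tree is closed upwards: an output determines its link, so at a node the net offers
  no link other than that of the tree.\<close>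

lemma tree_in_node_links:
  assumes "is_net S" "tree_in S t" "x \<in> set (nodes t)" "conn k a b x \<in># links S"
  shows "conn k a b x \<in># clinks t \<and> a \<in> set (nodes t) \<and> b \<in> set (nodes t)"
  using assms(2,3)
proof (induction t)
  case (Leaf p)
  then show ?case using initial_not_conn_target[OF assms(1)] assms(4) by simp
next
  case (Node k' p c d)
  show ?case
  proof (cases "x = p")
    case True
    then have "conn k a b x = conn k' (root c) (root d) p"
      using is_net_target_unique[OF assms(1,4), of "conn k' (root c) (root d) p" p] Node.prems(1) by simp
    then show ?thesis by simp
  next
    case False
    then show ?thesis using Node by auto
  qed
qed

lemma leaf_if_initial:
  assumes "is_net S" "tree_in S t" "x \<in> set (nodes t)" "x \<in> initials S"
  shows "x \<in> set (leaves t)"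
  using assms(2,3)
proof (induction t)
  case (Node k p a b)
  then show ?case using initial_not_conn_target[OF assms(1,4)] by auto
qed simp

definition tree_net :: "'p net \<Rightarrow> 'p ctree \<Rightarrow> bool" where
  "tree_net S t \<longleftrightarrow> is_net S \<and> cut_free S \<and> concl S = [root t] \<and> tree_in S t \<and>
     distinct (nodes t) \<and> set (nodes t) = positions S \<and> set (leaves t) = initials S"

text \<open>A position outside the tree is no conclusion, since the root is the only one. So it
  flows to another position, which cannot be in the tree either, because the tree is closed upwards;
  growing labels bound this descent.\<close>

lemma atomically_testableE:
  assumes "atomically_testable S [A]"
  obtains t \<tau> where "tree_net S t" "fits t A" "formula_labelling S \<tau>" "\<tau> (root t) = A"
proof -
  obtain \<tau> where net: "is_net S" "cut_free S" "atomic_labelling S \<tau>" "map \<tau> (concl S) = [A]"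
    using assms by (auto simp: atomically_testable_def)
  then have fl: "formula_labelling S \<tau>" by (simp add: atomic_labelling_def)
  obtain r where r: "concl S = [r]" "\<tau> r = A" using net(4) by auto
  have concl: "set (concl S) = {p \<in> positions S. \<forall>l \<in># links S. p \<notin> set (source l)}"
    using net(1) by (simp add: is_net_def)
  have "r \<in> positions S" using concl r(1) by auto
  then obtain t where t: "root t = r" "tree_in S t" "fits t A"
    using ex_tree_in[OF net(1,3)] r(2) by blast
  have "x \<in> set (nodes t)" if "x \<in> positions S" for x
  proof (rule ccontr)
    assume "x \<notin> set (nodes t)"
    \<comment> \<open>The largest label size exists because there are finitely many positions; the
      distance \<open>d\<close> to it decreases along the flow.\<close>
    let ?M = "Max (size ` \<tau> ` positions S)"
    define d where "d y = ?M - size (\<tau> y)" for y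
    from that \<open>x \<notin> set (nodes t)\<close> show False
    proof (induction "d x" arbitrary: x rule: less_induct)
      case less
      then have "x \<notin> set (concl S)" using r(1) t(1) by auto
      then obtain l where l: "l \<in># links S" "x \<in> set (source l)" using concl less.prems(1) by auto
      obtain k a b y where c: "conn k a b y \<in># links S" "x \<in> {a, b}"
        using l net(2) by (cases l rule: link_cases) (auto simp: cut_free_def)
      have y: "y \<in> positions S" using in_positionsI(2)[OF c(1), of y] by simp
      have "size (\<tau> x) < size (\<tau> y)"
        using flow_size[OF net(2) fl] conn_flow[OF c(1)] c(2) by auto
      moreover have "size (\<tau> y) \<le> ?M" using y finite_positions[of S] by simp
      ultimately have "d y < d x" by (simp add: d_def)
      then have "y \<in> set (nodes t)" using less.hyps y by blast
      then show False using tree_in_node_links[OF net(1) t(2) _ c(1)] c(2) less.prems(2) by auto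
    qed
  qed
  then have nodes: "set (nodes t) = positions S" using nodes_subset_positions[OF t(2)] by blast
  have "set (leaves t) = initials S"
  proof
    show "set (leaves t) \<subseteq> initials S" using t(2) by (simp add: tree_in_def)
    show "initials S \<subseteq> set (leaves t)"
      using leaf_if_initial[OF net(1) t(2)] initials_subset_positions[of S] unfolding nodes by auto
  qed
  then have "tree_net S t"
    using net r t nodes distinct_nodes[OF net(1,2) fl t(2)] by (simp add: tree_net_def)
  then show ?thesis using that t(1,3) fl r(2) by blast
qed

section \<open>Ranks of initial positions\<close>

fun addrs :: "'p ctree \<Rightarrow> (bool list \<times> 'p) list" where
  "addrs (Leaf p) = [([], p)]"
| "addrs (Node k p a b) = map (map_prod ((#) False) id) (addrs a) @ map (map_prod ((#) True) id) (addrs b)"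

lemma map_snd_addrs [simp]: "map snd (addrs t) = leaves t"
  by (induction t) (simp_all add: comp_def)

text \<open>At a node, all addresses in the left list start with \<open>False\<close> and all those
  in the right list with \<open>True\<close>, so concatenation preserves the order.\<close>

lemma sorted_addrs: "sorted_wrt (\<lambda>x y. (fst x, fst y) \<in> lexord {(False, True)}) (addrs t)"
  by (induction t) (auto simp: sorted_wrt_append sorted_wrt_map)

lemma Cons_in_map_prod_image [simp]:
  "(x # xs, y) \<in> map_prod ((#) z) id ` A \<longleftrightarrow> x = z \<and> (xs, y) \<in> A"
  by force

text \<open>Unique targets force an address to follow the tree. Restricting to initial
  \<open>p\<close> discards addresses that end at inner nodes.\<close>

lemma address_addrs:
  assumes "is_net S" "tree_in S t" "p \<in> initials S"
  shows "address S (root t) w p \<longleftrightarrow> (w, p) \<in> set (addrs t)"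
  using assms(2)
proof (induction t arbitrary: w)
  case (Leaf q)
  have "\<not> address S q (k # w) p" for k w
  proof
    assume "address S q (k # w) p"
    then obtain k' a b where "conn k' a b q \<in># links S"
      by (cases; metis conn.simps)
    then show False using initial_not_conn_target[OF assms(1)] Leaf by simp
  qed
  then have "address S q w p \<Longrightarrow> w = [] \<and> p = q"
    by (cases w) (auto elim: address.cases)
  then show ?case by (auto intro: address_here)
next
  case (Node k q a b)
  have c: "conn k (root a) (root b) q \<in># links S" using Node.prems by simp
  have uniq: "k' = k \<and> c = root a \<and> d = root b" if "conn k' c d q \<in># links S" for k' c d
    using is_net_target_unique[OF assms(1) that c, of q] by simp
  have uniq': "c = root a \<and> d = root b"
    if "ParLink c d q \<in># links S \<or> TensorLink c d q \<in># links S" for c d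
    using uniq[of True c d] uniq[of False c d] that by auto
  have c': "ParLink (root a) (root b) q \<in># links S \<or> TensorLink (root a) (root b) q \<in># links S"
    using c by (cases k) auto
  have "p \<noteq> q" using initial_not_conn_target[OF assms(1,3)] c by blast
  show ?case
  proof (cases w)
    case Nil
    have "\<not> address S q [] p" using \<open>p \<noteq> q\<close> by (auto elim: address.cases)
    then show ?thesis using Nil by auto
  next
    case (Cons z v)
    have "address S q (z # v) p \<longleftrightarrow> address S (if z then root b else root a) v p"
    proof
      assume "address S q (z # v) p"
      then show "address S (if z then root b else root a) v p"
        by cases (use uniq' in auto)
    next
      assume "address S (if z then root b else root a) v p"
      then show "address S q (z # v) p"
        using address_left[OF c'] address_right[OF c'] by (cases z) auto
    qed
    then show ?thesis using Node Cons by (cases z) auto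
  qed
qed

lemma lexord_bool_asym: "(u, v) \<in> lexord {(False, True)} \<Longrightarrow> (v, u) \<notin> lexord {(False, True)}"
  by (rule lexord_asymmetric) (auto intro: asymI)

text \<open>With one conclusion the index is always 0, so precedence is the order of addresses,
  which is the left-to-right order of leaves. List indices start at 0 and ranks at 1, whence
  \<open>Suc j\<close>.\<close>

lemma rank_leaf:
  assumes "tree_net S t" "j < length (leaves t)"
  shows "rank S (leaves t ! j) = Suc j"
proof -
  let ?L = "leaves t" and ?r = "lexord {(False, True)}"
  have len: "length (addrs t) = length ?L"
    by (metis length_map map_snd_addrs)
  have net: "is_net S" "tree_in S t" "concl S = [root t]" "set ?L = initials S" "distinct ?L"
    using assms(1) distinct_leaves by (auto simp: tree_net_def)
  have snd: "snd (addrs t ! i) = ?L ! i" if "i < length ?L" for i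
    using that len by (metis map_snd_addrs nth_map)
  have loc: "located S (?L ! i) k w \<longleftrightarrow> k = 0 \<and> w = fst (addrs t ! i)" if i: "i < length ?L" for i k w
  proof -
    have "?L ! i \<in> initials S" using i net(4) nth_mem by blast
    then have "located S (?L ! i) k w \<longleftrightarrow> k = 0 \<and> (w, ?L ! i) \<in> set (addrs t)"
      using address_addrs[OF net(1,2)] net(3) by (auto simp: located_def)
    also have "(w, ?L ! i) \<in> set (addrs t) \<longleftrightarrow> w = fst (addrs t ! i)"
    proof
      assume "(w, ?L ! i) \<in> set (addrs t)"
      then obtain m where m: "m < length ?L" "addrs t ! m = (w, ?L ! i)"
        using len by (metis in_set_conv_nth)
      then have "?L ! m = ?L ! i" using snd[of m] by simp
      then have "m = i" using m(1) i net(5) by (simp add: nth_eq_iff_index_eq)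
      then show "w = fst (addrs t ! i)" using m(2) by simp
    next
      assume "w = fst (addrs t ! i)"
      then have "(w, ?L ! i) = addrs t ! i" using snd[OF i] by (simp add: prod_eq_iff)
      then show "(w, ?L ! i) \<in> set (addrs t)" using i len by simp
    qed
    finally show ?thesis .
  qed
  have less: "(fst (addrs t ! i), fst (addrs t ! i')) \<in> ?r" if "i < i'" "i' < length ?L" for i i'
    using sorted_wrt_nth_less[OF sorted_addrs[of t], of i i'] that len by simp
  have prec: "precedes S (?L ! i) (?L ! j) \<longleftrightarrow> i < j" if i: "i < length ?L" for i
  proof -
    have "precedes S (?L ! i) (?L ! j) \<longleftrightarrow> (fst (addrs t ! i), fst (addrs t ! j)) \<in> ?r"
      using loc[OF i] loc[OF assms(2)] by (auto simp: precedes_def)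
    also have "\<dots> \<longleftrightarrow> i < j"
      using less[of i j] less[of j i] i assms(2) lexord_bool_asym by (metis nat_neq_iff)
    finally show ?thesis .
  qed
  have "{q \<in> initials S. precedes S q (?L ! j)} = (!) ?L ` {..<j}"
    using prec assms(2) unfolding net(4)[symmetric] set_conv_nth by auto
  moreover have "inj_on ((!) ?L) {..<j}"
    using net(5) assms(2) by (auto simp: inj_on_def nth_eq_iff_index_eq)
  ultimately show ?thesis by (simp add: rank_def card_image)
qed

section \<open>Switchings of nets and of trees\<close>

text \<open>
  \<open>chosen M K D\<close>: for each par link of \<open>M\<close>, the edge from the kept input to the output is
  in \<open>K\<close>, and the dropped input is in \<open>D\<close>.
\<close>

inductive chosen :: "'p link multiset \<Rightarrow> ('p \<times> 'p) set \<Rightarrow> 'p set \<Rightarrow> bool" where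
  chosen_empty: "chosen {#} {} {}"
| chosen_left: "chosen M K D \<Longrightarrow> chosen (add_mset (ParLink a b p) M) (insert (a, p) K) (insert b D)"
| chosen_right: "chosen M K D \<Longrightarrow> chosen (add_mset (ParLink a b p) M) (insert (b, p) K) (insert a D)"

lemma chosen_edge: "chosen M K D \<Longrightarrow> (x, y) \<in> K \<Longrightarrow> \<exists>a b. ParLink a b y \<in># M \<and> x \<in> {a, b}"
  by (induction rule: chosen.induct) auto

lemma chosen_dropped: "chosen M K D \<Longrightarrow> x \<in> D \<Longrightarrow> \<exists>a b y. ParLink a b y \<in># M \<and> x \<in> {a, b}"
  by (induction rule: chosen.induct) auto

lemma chosen_link: "chosen M K D \<Longrightarrow> l \<in># M \<Longrightarrow> \<exists>a b p. l = ParLink a b p"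
  by (induction rule: chosen.induct) auto

lemma chosen_flow:
  assumes "chosen M K D" "M \<subseteq># links S"
  shows "K \<subseteq> flow S"
proof (rule subrelI)
  fix x y
  assume "(x, y) \<in> K"
  then obtain a b where "ParLink a b y \<in># M" "x \<in> {a, b}"
    using chosen_edge[OF assms(1)] by blast
  then show "(x, y) \<in> flow S"
    using conn_flow[of True a b y S] mset_subset_eqD[OF assms(2)] by auto
qed

text \<open>A par link of a net occurs once and its inputs feed no other link, so no other choice in
  \<open>M\<close> can affect them.\<close>

lemma chosen_exclusive:
  assumes "is_net S"
  shows "chosen M K D \<Longrightarrow> M \<subseteq># links S \<Longrightarrow> ParLink a b p \<in># M \<Longrightarrow>
    (a, p) \<in> K \<and> b \<in> D \<and> b \<notin> Domain K \<and> a \<notin> D \<or> (b, p) \<in> K \<and> a \<in> D \<and> a \<notin> Domain K \<and> b \<notin> D"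
proof (induction arbitrary: a b p rule: chosen.induct)
  have fresh: "x \<notin> Domain K \<and> x \<notin> D"
    if M: "add_mset (ParLink a b p) M \<subseteq># links S" and "chosen M K D" "x \<in> {a, b}" for M K D a b p x
  proof -
    have sub: "M \<subseteq># links S" "ParLink a b p \<in># links S"
      using M by (auto dest: mset_subset_eq_insertD intro: subset_mset.less_imp_le)
    have "count (add_mset (ParLink a b p) M) (ParLink a b p) \<le> 1"
      using is_net_count[OF assms sub(2)] mset_subset_eq_count[OF M, of "ParLink a b p"] by simp
    then have "ParLink a b p \<notin># M" by (simp add: not_in_iff)
    then have "ParLink c d y \<notin># M" if "x \<in> {c, d}" for c d y
      using is_net_source_unique[OF assms sub(2), of "ParLink c d y" x] that \<open>x \<in> {a, b}\<close>
        mset_subset_eqD[OF sub(1), of "ParLink c d y"] by auto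
    then show ?thesis
      using chosen_edge[OF \<open>chosen M K D\<close>, of x] chosen_dropped[OF \<open>chosen M K D\<close>, of x] by blast
  qed
  have diff: "a \<noteq> b" if "ParLink a b p \<in># links S" for a b p
    using assms that unfolding is_net_def by force
  have uniq: "{a, b} \<inter> {c, d} = {}"
    if "ParLink a b p \<in># links S" "ParLink c d q \<in># links S" "ParLink a b p \<noteq> ParLink c d q"
    for a b c d p q
    using is_net_source_unique[OF assms that(1,2)] that(3) by auto
  {
    case chosen_empty
    then show ?case by simp
  next
    case (chosen_left M K D c d q)
    have sub: "M \<subseteq># links S" "ParLink c d q \<in># links S" "ParLink a b p \<in># links S"
      using chosen_left.prems mset_subset_eqD[OF chosen_left.prems(1)]
      by (auto dest: mset_subset_eq_insertD intro: subset_mset.less_imp_le)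
    show ?case
    proof (cases "ParLink a b p = ParLink c d q")
      case True
      then show ?thesis
        using fresh[OF chosen_left.prems(1) chosen_left.hyps, of a]
          fresh[OF chosen_left.prems(1) chosen_left.hyps, of b] diff[OF sub(2)] by auto
    next
      case False
      then show ?thesis
        using chosen_left.IH[OF sub(1), of a b p] chosen_left.prems(2) uniq[OF sub(3,2)] by auto
    qed
  next
    case (chosen_right M K D c d q)
    have sub: "M \<subseteq># links S" "ParLink c d q \<in># links S" "ParLink a b p \<in># links S"
      using chosen_right.prems mset_subset_eqD[OF chosen_right.prems(1)]
      by (auto dest: mset_subset_eq_insertD intro: subset_mset.less_imp_le)
    show ?case
    proof (cases "ParLink a b p = ParLink c d q")
      case True
      then show ?thesis
        using fresh[OF chosen_right.prems(1) chosen_right.hyps, of a]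
          fresh[OF chosen_right.prems(1) chosen_right.hyps, of b] diff[OF sub(2)] by auto
    next
      case False
      then show ?thesis
        using chosen_right.IH[OF sub(1), of a b p] chosen_right.prems(2) uniq[OF sub(3,2)] by auto
    qed
  }
qed

section \<open>The cumulative effect of switching steps\<close>

lemma retarget_id: "retarget id = id"
proof
  show "retarget id l = id l" for l :: "'a link" by (cases l) simp_all
qed

lemma retarget_comp: "retarget g (retarget f l) = retarget (g \<circ> f) l"
  by (cases l) simp_all

lemma retarget_eq_ParLink:
  "retarget f l = ParLink a b p \<longleftrightarrow> (\<exists>q. l = ParLink a b q \<and> f q = p)"
  by (cases l) auto

text \<open>\<open>L\<close> holds the links of \<open>S\<close> that survive up to retargeting,
  \<open>M\<close> those deleted. The last clause says that \<open>f\<close> moves each position to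
  the end of its path of kept edges; these edges are recorded with the original positions of
  \<open>S\<close>.\<close>

definition switch_inv ::
    "'p net \<Rightarrow> ('p \<Rightarrow> 'p) \<Rightarrow> 'p net \<Rightarrow> 'p link multiset \<Rightarrow> 'p link multiset \<Rightarrow> ('p \<times> 'p) set \<Rightarrow> 'p set \<Rightarrow> bool" where
  "switch_inv S f S' L M K D \<longleftrightarrow> links S = L + M \<and> chosen M K D \<and>
     links S' = image_mset (retarget f) L \<and> set (concl S') = set (concl S) \<union> D \<and>
     (\<forall>x. (x, f x) \<in> K\<^sup>* \<and> f x \<notin> Domain K)"

lemma switch_inv_ex:
  "switch_steps S f S' \<Longrightarrow> cut_free S \<Longrightarrow> formula_labelling S \<tau> \<Longrightarrow> \<exists>L M K D. switch_inv S f S' L M K D"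
proof (induction rule: switch_steps.induct)
  case (switch_refl S)
  have "switch_inv S id S (links S) {#} {} {}"
    by (simp add: switch_inv_def retarget_id chosen_empty)
  then show ?case by blast
next
  case (switch_trans S f S' g S'')
  obtain L M K D where inv: "links S = L + M" "chosen M K D" "links S' = image_mset (retarget f) L"
      "set (concl S') = set (concl S) \<union> D" "\<And>x. (x, f x) \<in> K\<^sup>*" "\<And>x. f x \<notin> Domain K"
    using switch_trans.IH[OF switch_trans.prems] by (auto simp: switch_inv_def)
  \<comment> \<open>Here \<open>c\<close> is the kept input and \<open>d\<close> the dropped one, so
    that a single argument covers left and right steps.\<close>
  have main: "\<exists>L M K D. switch_inv S (id(c := p) \<circ> f) (Net (image_mset (retarget (id(c := p))) N) (cs @ [d])) L M K D"
    if S': "S' = Net (N + {#ParLink a b p#}) cs"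
      and ch: "\<And>M K D q. chosen M K D \<Longrightarrow> chosen (add_mset (ParLink a b q) M) (insert (c, q) K) (insert d D)"
      and c: "c \<in> {a, b}"
    for N a b p cs c d
  proof -
    have "image_mset (retarget f) L = add_mset (ParLink a b p) N"
      using inv(3) S' by simp
    then obtain L' l where L: "L = add_mset l L'" "retarget f l = ParLink a b p" "image_mset (retarget f) L' = N"
      by (metis msed_map_invR)
    \<comment> \<open>Earlier steps never change sources but may have renamed the output
      \<open>q\<close> of the original link to \<open>p\<close>; the new kept edge must therefore
      end in \<open>q\<close>.\<close>
    then obtain q where q: "l = ParLink a b q" "f q = p"
      unfolding retarget_eq_ParLink by blast
    let ?K = "insert (c, q) K" and ?g = "id(c := p) \<circ> f"
    have mono: "K\<^sup>* \<subseteq> ?K\<^sup>*" by (rule rtrancl_mono) blast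
    have "K \<subseteq> flow S" using chosen_flow[OF inv(2)] inv(1) by simp
    then have "(q, p) \<in> (flow S)\<^sup>*" using inv(5)[of q] q(2) rtrancl_mono by blast
    then have "size (\<tau> q) \<le> size (\<tau> p)" using flow_rtrancl_size[OF switch_trans.prems] by blast
    moreover have "(c, q) \<in> flow S"
      using conn_flow[of True a b q S] inv(1) L(1) q(1) c by auto
    then have "size (\<tau> c) < size (\<tau> q)" using flow_size[OF switch_trans.prems] by blast
    \<comment> \<open>Otherwise the kept edges would contain a cycle and \<open>p\<close> would not
      be the end of a path.\<close>
    ultimately have "p \<noteq> c" by auto
    have "(x, ?g x) \<in> ?K\<^sup>* \<and> ?g x \<notin> Domain ?K" for x
    proof (cases "f x = c")
      case True
      have "(x, c) \<in> ?K\<^sup>*" using inv(5)[of x] True mono by auto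
      moreover have "(c, q) \<in> ?K" by simp
      moreover have "(q, p) \<in> ?K\<^sup>*" using inv(5)[of q] q(2) mono by auto
      ultimately have "(x, p) \<in> ?K\<^sup>*" by (meson rtrancl.rtrancl_into_rtrancl rtrancl_trans)
      then show ?thesis using True \<open>p \<noteq> c\<close> inv(6)[of q] q(2) by simp
    next
      case False
      then show ?thesis using inv(5,6)[of x] mono by auto
    qed
    moreover have "image_mset (retarget (id(c := p))) N = image_mset (retarget ?g) L'"
      unfolding L(3)[symmetric] by (simp add: multiset.map_comp comp_def retarget_comp)
    moreover have "chosen (add_mset (ParLink a b q) M) ?K (insert d D)"
      by (rule ch[OF inv(2)])
    ultimately show ?thesis
      using inv(1,4) L(1) q(1) S'
      by (intro exI[of _ L'] exI[of _ "add_mset l M"] exI[of _ ?K] exI[of _ "insert d D"])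
        (simp add: switch_inv_def)
  qed
  from switch_trans.hyps(2) show ?case
  proof cases
    case (switch_left N a b p cs)
    show ?thesis
      unfolding switch_left(2,3) by (rule main[OF switch_left(1) chosen_left]) auto
  next
    case (switch_right N a b p cs)
    show ?thesis
      unfolding switch_right(2,3) by (rule main[OF switch_right(1) chosen_right]) auto
  qed
qed

text \<open>The renaming \<open>f\<close> contracts the kept par edges, so the classes can be
  computed in \<open>S\<close> itself as reachability along \<open>E\<close>; there they obey the
  recursion of \<open>switched\<close>.\<close>

lemma switching_tree:
  assumes S: "tree_net S t" "formula_labelling S \<tau>" and sw: "switching S f R"
  shows "\<exists>c D. switched t c D \<and> up_part S f R = insert c D"
proof -
  have net: "is_net S" "cut_free S" "concl S = [root t]" "tree_in S t" "distinct (nodes t)"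
      "set (nodes t) = positions S"
    using S(1) by (auto simp: tree_net_def)
  obtain L M K D where inv: "links S = L + M" "chosen M K D" "links R = image_mset (retarget f) L"
      "set (concl R) = insert (root t) D" "\<And>x. (x, f x) \<in> K\<^sup>*" "\<And>x. f x \<notin> Domain K"
    using switch_inv_ex[OF _ net(2) S(2), of f R] sw net(3) by (auto simp: switching_def switch_inv_def)
  have M: "M \<subseteq># links S" using inv(1) by simp
  \<comment> \<open>Retargeting preserves the kind of a link, so a surviving par link would permit
    another step, against normality.\<close>
  have no_par: "ParLink a b p \<notin># L" for a b p
  proof
    assume "ParLink a b p \<in># L"
    then have "ParLink a b (f p) \<in># links R" unfolding inv(3) by (auto intro!: image_eqI)
    then obtain N where "links R = N + {#ParLink a b (f p)#}" by (metis insert_DiffM add_mset_add_single)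
    then have "R = Net (N + {#ParLink a b (f p)#}) (concl R)" by (metis net.collapse)
    then show False using sw switch_left unfolding switching_def by metis
  qed
  have par: "ParLink a b p \<in># links S \<longleftrightarrow> ParLink a b p \<in># M" for a b p
    using no_par inv(1) by simp
  have tensor: "TensorLink a b p \<in># links S \<longleftrightarrow> TensorLink a b p \<in># L" for a b p
    using chosen_link[OF inv(2), of "TensorLink a b p"] inv(1) by auto
  note excl = chosen_exclusive[OF net(1) inv(2) M]
  define T where "T = {(x, p). \<exists>a b. TensorLink a b p \<in># links S \<and> x \<in> {a, b}}"
  define E where "E = K \<union> T"
  have KE: "K\<^sup>* \<subseteq> E\<^sup>*" by (rule rtrancl_mono) (simp add: E_def)
  have E_conn: "\<exists>k a b. conn k a b y \<in># links S \<and> x \<in> {a, b}" if xy: "(x, y) \<in> E" for x y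
  proof -
    obtain a b where "ParLink a b y \<in># links S \<or> TensorLink a b y \<in># links S" "x \<in> {a, b}"
      using xy chosen_edge[OF inv(2), of x y] unfolding E_def T_def par by auto
    then show ?thesis using exI[of "\<lambda>k. conn k a b y \<in># links S" True]
      exI[of "\<lambda>k. conn k a b y \<in># links S" False] by auto
  qed
  have T_K: "x \<notin> Domain K \<and> x \<notin> D" if "TensorLink a b p \<in># links S" "x \<in> {a, b}" for a b p x
  proof -
    have "ParLink c d q \<notin># M" if "x \<in> {c, d}" for c d q
      using is_net_source_unique[OF net(1) \<open>TensorLink a b p \<in># links S\<close>, of "ParLink c d q" x]
        \<open>x \<in> {a, b}\<close> that unfolding par[symmetric] by auto
    then show ?thesis
      using chosen_edge[OF inv(2), of x] chosen_dropped[OF inv(2), of x] by blast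
  qed
  have f_fix: "f x = x" if "x \<notin> Domain K" for x
    using inv(5)[of x] that by (simp add: Not_Domain_rtrancl)
  have svK: "single_valued K"
    using single_valued_subset[OF chosen_flow[OF inv(2) M] single_valued_flow[OF net(1,2)]] .
  have f_K: "f x = f y" if "(x, y) \<in> K\<^sup>*" for x y
  proof -
    have "(x, f y) \<in> K\<^sup>*" using that inv(5)[of y] by (rule rtrancl_trans)
    then have "(f x, f y) \<in> K\<^sup>* \<or> (f y, f x) \<in> K\<^sup>*"
      using single_valued_confluent[OF svK inv(5)[of x]] by blast
    then show ?thesis using inv(6)[of x] inv(6)[of y] by (auto simp: Not_Domain_rtrancl)
  qed
  have flow_R: "(x, z) \<in> flow R \<longleftrightarrow> (\<exists>y. (x, y) \<in> T \<and> z = f y)" for x z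
  proof
    assume "(x, z) \<in> flow R"
    then obtain l where l: "l \<in># L" "x \<in> set (source (retarget f l))" "z \<in> set (target (retarget f l))"
      unfolding flow_def inv(3) by auto
    then show "\<exists>y. (x, y) \<in> T \<and> z = f y"
      using no_par inv(1) by (cases l) (auto simp: T_def)
  next
    assume "\<exists>y. (x, y) \<in> T \<and> z = f y"
    then obtain a b y where "TensorLink a b y \<in># L" "x \<in> {a, b}" "z = f y"
      unfolding T_def tensor by auto
    then show "(x, z) \<in> flow R"
      unfolding flow_def inv(3) by (auto intro!: bexI[of _ "TensorLink a b y"])
  qed
  have to_R: "(f x, f y) \<in> (flow R)\<^sup>*" if "(x, y) \<in> E\<^sup>*" for x y
    using that
  proof (induction rule: rtrancl_induct)
    case (step y z)
    show ?case
    proof (cases "(y, z) \<in> K")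
      case True
      then have "f y = f z" by (intro f_K) auto
      then show ?thesis using step.IH by simp
    next
      case False
      then have "(y, z) \<in> T" using step.hyps by (simp add: E_def)
      moreover have "f y = y" using calculation T_K f_fix[of y] by (auto simp: T_def)
      ultimately have "(f y, f z) \<in> flow R" unfolding flow_R by auto
      with step.IH show ?thesis by (rule rtrancl_into_rtrancl)
    qed
  qed simp
  \<comment> \<open>A position of \<open>R\<close> may stand for several positions of
    \<open>S\<close>, so the claim covers all preimages; the induction step applies it to the output
    \<open>y\<close> before renaming.\<close>
  have from_R: "\<forall>x. f x = u \<longrightarrow> (x, q) \<in> E\<^sup>*" if "(u, q) \<in> (flow R)\<^sup>*" for u q
    using that
  proof (induction rule: converse_rtrancl_induct)
    case base
    then show ?case using inv(5) KE by blast
  next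
    case (step u v)
    show ?case
    proof (intro allI impI)
      fix x
      assume x: "f x = u"
      obtain y where y: "(u, y) \<in> T" "v = f y" using step.hyps(1) unfolding flow_R by blast
      have "(x, u) \<in> E\<^sup>*" using inv(5)[of x] x KE by auto
      moreover have "(u, y) \<in> E" using y(1) by (simp add: E_def)
      moreover have "(y, q) \<in> E\<^sup>*" using step.IH y(2) by blast
      ultimately show "(x, q) \<in> E\<^sup>*" by (meson rtrancl.rtrancl_into_rtrancl rtrancl_trans)
    qed
  qed
  have src: "root t \<notin> set (source l)" if "l \<in># links S" for l
    using net(1,3) that unfolding is_net_def by force
  \<comment> \<open>No kept edge starts at a conclusion of \<open>R\<close>, so \<open>f\<close>
    fixes these positions.\<close>
  have D_dom: "q \<notin> Domain K" if "q \<in> insert (root t) D" for q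
  proof
    assume "q \<in> Domain K"
    then obtain a b y where ab: "ParLink a b y \<in># M" "q \<in> {a, b}" "(q, y) \<in> K"
      using chosen_edge[OF inv(2)] by blast
    have "q \<noteq> root t" using src[of "ParLink a b y"] ab(1,2) unfolding par[symmetric] by auto
    then have "q \<in> D" using that by simp
    then show False using excl[OF ab(1)] ab(2) \<open>q \<in> Domain K\<close> by auto
  qed
  define cls where "cls q = {p \<in> initials S. (p, q) \<in> E\<^sup>*}" for q
  have "{p \<in> initials S. (f p, q) \<in> (flow R)\<^sup>*} = cls q" if "q \<in> insert (root t) D" for q
    using to_R[of _ q] from_R[of _ q] f_fix[OF D_dom[OF that]] unfolding cls_def by auto
  then have up: "up_part S f R = cls ` insert (root t) D"
    unfolding up_part_def inv(4) by (auto intro!: image_cong)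
  have cls_leaf: "cls p = {p}" if "p \<in> initials S" for p
  proof -
    have "(x, p) \<notin> E" for x
      using E_conn[of x p] initial_not_conn_target[OF net(1) that] by blast
    then have "(x, p) \<in> E\<^sup>* \<longleftrightarrow> x = p" for x by (metis rtrancl.cases rtrancl.rtrancl_refl)
    then show ?thesis using that by (auto simp: cls_def)
  qed
  \<comment> \<open>An initial position is not the output of a connective link, so it reaches
    \<open>p\<close> only through an input whose edge is kept.\<close>
  have cls_node: "cls p = (if (a, p) \<in> E then cls a else {}) \<union> (if (b, p) \<in> E then cls b else {})"
    if c: "conn k a b p \<in># links S" for k a b p
  proof -
    have pre: "x \<in> {a, b}" if xp: "(x, p) \<in> E" for x
    proof -
      obtain k' a' b' where c': "conn k' a' b' p \<in># links S" "x \<in> {a', b'}" using E_conn[OF xp] by blast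
      then show ?thesis using is_net_target_unique[OF net(1) c c'(1), of p] by auto
    qed
    have "x \<noteq> p" if "x \<in> initials S" for x
      using initial_not_conn_target[OF net(1) that] c by blast
    then have "x \<in> cls p \<longleftrightarrow> (\<exists>y. (y, p) \<in> E \<and> x \<in> cls y)" for x
      unfolding cls_def mem_Collect_eq by (metis rtrancl.cases rtrancl.rtrancl_into_rtrancl)
    then show ?thesis using pre by (auto split: if_splits)
  qed
  \<comment> \<open>The root of \<open>u\<close> is left out because whether it is dropped is
    decided by the link below \<open>u\<close>.\<close>
  have "switched u (cls (root u)) (cls ` (D \<inter> (set (nodes u) - {root u})))"
    if "tree_in S u" "distinct (nodes u)" for u
    using that
  proof (induction u)
    case (Leaf p)
    then show ?case using cls_leaf[of p] switched_leaf by simp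
  next
    case (Node k p a b)
    have c: "conn k (root a) (root b) p \<in># links S" using Node.prems by simp
    have a: "switched a (cls (root a)) (cls ` (D \<inter> (set (nodes a) - {root a})))"
      using Node by simp
    have b: "switched b (cls (root b)) (cls ` (D \<inter> (set (nodes b) - {root b})))"
      using Node by simp
    have nodes: "D \<inter> (set (nodes (Node k p a b)) - {p}) =
        D \<inter> {root a} \<union> D \<inter> {root b} \<union>
        (D \<inter> (set (nodes a) - {root a}) \<union> D \<inter> (set (nodes b) - {root b}))"
      using Node.prems(2) root_in_nodes[of a] root_in_nodes[of b] by auto
    show ?case
    proof (cases k)
      case False
      then have t: "TensorLink (root a) (root b) p \<in># links S" using c by simp
      then have "(root a, p) \<in> E" "(root b, p) \<in> E" by (auto simp: E_def T_def)
      moreover have "root a \<notin> D" "root b \<notin> D" using T_K[OF t] by auto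
      ultimately show ?thesis
        using switched_tensor[OF a b, of p] False cls_node[OF c] unfolding ctree.sel nodes
        by (simp add: image_Un)
    next
      case True
      then have t: "ParLink (root a) (root b) p \<in># links S" using c by simp
      then have noT: "(x, p) \<notin> T" for x
        using is_net_target_unique[OF net(1) t, of "TensorLink _ _ p" p] unfolding T_def by auto
      have "ParLink (root a) (root b) p \<in># M" using t unfolding par .
      from excl[OF this] show ?thesis
      proof (elim disjE conjE)
        assume *: "(root a, p) \<in> K" "root b \<in> D" "root b \<notin> Domain K" "root a \<notin> D"
        then have "(root a, p) \<in> E" "(root b, p) \<notin> E" using noT by (auto simp: E_def)
        then show ?thesis
          using switched_left[OF a b, of p] True cls_node[OF c] *(2,4) unfolding ctree.sel nodes
          by (simp add: image_Un)
      next
        assume *: "(root b, p) \<in> K" "root a \<in> D" "root a \<notin> Domain K" "root b \<notin> D"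
        then have "(root b, p) \<in> E" "(root a, p) \<notin> E" using noT by (auto simp: E_def)
        then show ?thesis
          using switched_right[OF a b, of p] True cls_node[OF c] *(2,4) unfolding ctree.sel nodes
          by (simp add: image_Un)
      qed
    qed
  qed
  moreover have "D \<inter> (set (nodes t) - {root t}) = D"
  proof -
    have "x \<in> set (nodes t) \<and> x \<noteq> root t" if xD: "x \<in> D" for x
    proof -
      obtain a b y where ab: "ParLink a b y \<in># links S" "x \<in> {a, b}"
        using chosen_dropped[OF inv(2) xD] unfolding par[symmetric] by blast
      then show ?thesis
        using in_positionsI(1)[OF ab(1), of x] src[OF ab(1)] unfolding net(6) by auto
    qed
    then show ?thesis by blast
  qed
  ultimately have "switched t (cls (root t)) (cls ` D)" using net(4,5) by metis
  then show ?thesis using up by auto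
qed

section \<open>Daimon links as classes\<close>

lemma clinks_conn: "l \<in># clinks t \<Longrightarrow> \<exists>k a b p. l = conn k a b p \<and> p \<in> set (nodes t)"
  by (induction t) auto

lemma count_clinks: "distinct (nodes t) \<Longrightarrow> l \<in># clinks t \<Longrightarrow> count (clinks t) l = 1"
proof (induction t)
  case (Node k p a b)
  let ?l = "conn k (root a) (root b) p"
  have d: "distinct (nodes a)" "distinct (nodes b)" "set (nodes a) \<inter> set (nodes b) = {}"
      "p \<notin> set (nodes a)" "p \<notin> set (nodes b)"
    using Node.prems(1) by auto
  have 1: "?l \<notin># clinks a" "?l \<notin># clinks b"
    using clinks_conn[of ?l a] clinks_conn[of ?l b] d(4,5) by auto
  have 2: "l \<notin># clinks a \<or> l \<notin># clinks b"
    using clinks_conn[of l a] clinks_conn[of l b] d(3) by (metis IntI conn_inject empty_iff)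
  show ?case
  proof (cases "l = ?l")
    case True
    then show ?thesis using 1 by (simp add: not_in_iff)
  next
    case False
    then show ?thesis
      using 2 Node.IH(1)[OF d(1)] Node.IH(2)[OF d(2)] Node.prems(2) by (auto simp: not_in_iff)
  qed
qed simp

text \<open>Multiplicities are compared link by link. Without empty classes every daimon link has an
  output, hence occurs once and is determined by its set of outputs.\<close>

lemma tree_net_links:
  assumes T: "tree_net T t" and ne: "{} \<notin> daimon_part T"
    and enum: "\<And>X. X \<in> daimon_part T \<Longrightarrow> DaimonLink (enum X) \<in># links T \<and> set (enum X) = X"
  shows "links T = clinks t + daimons enum (daimon_part T)"
proof (rule multiset_eqI)
  fix l
  let ?h = "\<lambda>X. DaimonLink (enum X)" and ?P = "daimon_part T"
  have net: "is_net T" "cut_free T" "tree_in T t" "distinct (nodes t)" "set (nodes t) = positions T"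
    using T by (auto simp: tree_net_def)
  have "finite (DaimonLink -` set_mset (links T))"
    by (rule finite_vimageI) (auto intro: injI)
  moreover have "?P = set ` (DaimonLink -` set_mset (links T))"
    by (auto simp: daimon_part_def)
  ultimately have "finite ?P" by simp
  moreover have "inj_on ?h ?P"
    using enum by (metis (mono_tags, lifting) inj_onI link.inject(4))
  then have h: "daimons enum ?P = mset_set (?h ` ?P)" by (rule image_mset_mset_set)
  ultimately have count_h: "count (daimons enum ?P) l = (if l \<in> ?h ` ?P then 1 else 0)"
    by (simp add: count_mset_set')
  show "count (links T) l = count (clinks t + daimons enum ?P) l"
  proof (cases l rule: link_cases)
    case (conn k a b p)
    then have 0: "count (daimons enum ?P) l = 0" unfolding count_h by auto
    have "l \<in># links T \<longleftrightarrow> l \<in># clinks t"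
    proof
      assume l: "l \<in># links T"
      have "p \<in> set (nodes t)" using in_positionsI(2)[OF l, of p] conn net(5) by simp
      then show "l \<in># clinks t" using tree_in_node_links[OF net(1,3)] l conn by blast
    qed (use net(3) in \<open>auto simp: tree_in_def\<close>)
    then show ?thesis
      using 0 is_net_count[OF net(1), of l] count_clinks[OF net(4), of l] conn
      by (cases "l \<in># links T") (auto simp: not_in_iff)
  next
    case (cut a b)
    then have "l \<notin># links T" "l \<notin># clinks t" "l \<notin> ?h ` ?P"
      using net(2) clinks_conn[of l t] by (auto simp: cut_free_def)
    then show ?thesis using count_h by (simp add: not_in_iff)
  next
    case (daimon ps)
    then have 0: "count (clinks t) l = 0"
      using clinks_conn[of l t] by (auto simp: count_eq_zero_iff)
    have "l \<in># links T \<longleftrightarrow> l \<in> ?h ` ?P"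
    proof
      assume l: "l \<in># links T"
      then have ps: "set ps \<in> ?P" using daimon by (auto simp: daimon_part_def)
      then obtain p where p: "p \<in> set ps" using ne by (metis equals0I)
      have "l = ?h (set ps)"
        by (rule is_net_target_unique[OF net(1) l, of _ p]) (use enum[OF ps] p daimon in auto)
      then show "l \<in> ?h ` ?P" using ps by blast
    qed (use enum in auto)
    moreover have "target l \<noteq> []" if "l \<in># links T"
      using that ne daimon by (auto simp: daimon_part_def)
    ultimately show ?thesis
      using 0 count_h is_net_count[OF net(1), of l] by (cases "l \<in># links T") (auto simp: not_in_iff)
  qed
qed

theorem theorem77:
  fixes dual :: "'v::countable \<Rightarrow> 'v"
    and A :: "'v formula"
    and T :: "'p::countable net"
  assumes "\<And>X. dual (dual X) = X"
    and "test dual A T"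
  shows "typeable dual T [neg dual A]"
proof -
  obtain S :: "'p net" and f R where
    T: "atomically_testable T [neg dual A]" and S: "atomically_testable S [A]"
    and sw: "switching S f R" and nat: "Nat_part T (daimon_part T) = Nat_part S (up_part S f R)"
    using assms(2) by (auto simp: test_def)
  obtain t \<tau> where t: "tree_net T t" "fits t (neg dual A)" "formula_labelling T \<tau>" "\<tau> (root t) = neg dual A"
    using T by (rule atomically_testableE)
  obtain s and \<tau>' :: "'p \<Rightarrow> 'v formula" where s: "tree_net S s" "fits s A" "formula_labelling S \<tau>'"
    using S by (rule atomically_testableE) blast
  have Tnet: "is_net T" "concl T = [root t]" "tree_in T t" "distinct (nodes t)" "set (leaves t) = initials T"
    using t(1) by (auto simp: tree_net_def)
  have Snet: "distinct (nodes s)" using s(1) by (auto simp: tree_net_def)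
  \<comment> \<open>The tree of \<open>T\<close> fits the dual of \<open>A\<close>, so its flip fits
    \<open>A\<close>, just as \<open>s\<close> does.\<close>
  obtain \<phi> where \<phi>: "map_ctree \<phi> s = flip t"
    using ex_map_ctree[OF s(2) t(2)[unfolded fits_flip] Snet] by blast
  obtain c D where cD: "switched s c D" "up_part S f R = insert c D"
    using switching_tree[OF s(1,3) sw] by blast
  define c' D' where "c' = \<phi> ` c" and "D' = (`) \<phi> ` D"
  have sw': "switched (flip t) c' D'"
    using switched_map[OF cD(1), of \<phi>] unfolding \<phi> c'_def D'_def .
  have leaves: "leaves t = map \<phi> (leaves s)"
    using leaves_map_ctree[of \<phi> s] unfolding \<phi> by simp
  \<comment> \<open>\<open>\<phi>\<close> preserves the index of a leaf, and the rank depends on the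
    index alone.\<close>
  have rank: "rank T (\<phi> p) = rank S p" if p: "p \<in> set (leaves s)" for p
  proof -
    obtain i where i: "i < length (leaves s)" "p = leaves s ! i" using p by (auto simp: in_set_conv_nth)
    then show ?thesis using rank_leaf[OF s(1), of i] rank_leaf[OF t(1), of i] leaves by simp
  qed
  have inj: "inj_on (rank T) (set (leaves t))"
  proof (rule inj_onI)
    fix x y
    assume xy: "x \<in> set (leaves t)" "y \<in> set (leaves t)" "rank T x = rank T y"
    obtain i j where ij: "i < length (leaves t)" "x = leaves t ! i" "j < length (leaves t)" "y = leaves t ! j"
      using xy(1,2) by (auto simp: in_set_conv_nth)
    then have "i = j" using xy(3) rank_leaf[OF t(1)] by simp
    then show "x = y" using ij by simp
  qed
  have "rank S ` X = rank T ` \<phi> ` X" if "X \<in> insert c D" for X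
  proof -
    have "X \<subseteq> set (leaves s)" using switched_classes(3)[OF cD(1)] that by auto
    then show ?thesis using rank by (auto simp: image_image intro!: image_cong)
  qed
  then have "Nat_part S (up_part S f R) = (`) (rank T) ` insert c' D'"
    unfolding cD(2) Nat_part_def c'_def D'_def by (simp add: image_image)
  then have eq: "(`) (rank T) ` daimon_part T = (`) (rank T) ` insert c' D'"
    using nat by (simp add: Nat_part_def)
  have "daimon_part T \<subseteq> Pow (set (leaves t))"
    unfolding Tnet(5) by (auto simp: daimon_part_def initials_def)
  moreover have "insert c' D' \<subseteq> Pow (set (leaves t))"
    using switched_classes(3)[OF sw'] by auto
  \<comment> \<open>Since \<open>rank T\<close> is injective on leaves, taking images is injective
    on sets of leaves, and so is taking images of families of such sets.\<close>
  ultimately have daimon: "daimon_part T = insert c' D'"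
    using eq by (rule inj_on_image_eq_iff[OF inj_on_image_Pow[OF inj], THEN iffD1])
  have ne: "{} \<notin> daimon_part T"
    unfolding daimon by (rule switched_classes(2)[OF sw'])
  have "\<forall>X \<in> daimon_part T. \<exists>ps. DaimonLink ps \<in># links T \<and> set ps = X"
    by (auto simp: daimon_part_def)
  then obtain enum where enum: "\<And>X. X \<in> daimon_part T \<Longrightarrow> DaimonLink (enum X) \<in># links T \<and> set (enum X) = X"
    by metis
  have dist: "distinct (enum X)" if "X \<in> daimon_part T" for X
    using Tnet(1) enum[OF that] unfolding is_net_def by fastforce
  \<comment> \<open>This splits off the daimon of the root class as the initial net of the
    gluing.\<close>
  have "c' \<notin> D'" using switched_root_class_notin[OF sw'] Tnet(4) by simp
  then have links: "links T = {#DaimonLink (enum c')#} + clinks t + daimons enum D'"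
    using tree_net_links[OF t(1) ne enum] switched_classes(1)[OF sw'] unfolding daimon by simp
  have c'_nodes: "c' \<subseteq> set (nodes t)"
    using switched_class_subset[OF sw', of c'] by simp
  have enum_c: "distinct (enum c')" "set (enum c') = c'"
    using enum dist unfolding daimon by auto
  have lab: "formula_labelling (Net (clinks (flip (flip t))) []) \<tau>"
    using t(3) links by (auto simp: formula_labelling_def)
  \<comment> \<open>The switched tree is \<open>flip t\<close>, so the tree to be glued is its dual,
    \<open>flip (flip t)\<close>, which is \<open>t\<close>.\<close>
  have "typeable dual (Net ({#DaimonLink (enum c')#} + clinks (flip (flip t)) + daimons enum D')
      ([] @ [root (flip t)])) (map \<tau> ([] @ [root (flip t)]))"
  proof (rule typeable_switched[OF sw' _ _ lab _ enum_c])
    show "distinct (enum X) \<and> set (enum X) = X" if "X \<in> D'" for X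
      using that enum dist unfolding daimon by blast
    show "typeable dual (Net {#DaimonLink (enum c')#} ([] @ enum c')) (map \<tau> ([] @ enum c'))"
      using typeable_daimon[OF enum_c(1)] by simp
    show "positions (Net {#DaimonLink (enum c')#} []) \<inter> set (nodes (flip t)) = c'"
      using enum_c(2) c'_nodes by (auto simp: positions_def)
  qed (simp add: Tnet(4))
  moreover have "T = Net ({#DaimonLink (enum c')#} + clinks t + daimons enum D') [root t]"
    using links Tnet(2) by (metis net.collapse)
  ultimately show ?thesis using t(4) by simp
qed

end
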